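(* Let $(K,d)$ be a compact metric space and let $\gamma=(\gamma(t);0\le t\le1)$ be an $\mathcal{M}(K)$-valued path with finite energy with respect to the Wasserstein distance. Then there is a $K$-valued stochastic process $X=(X(t);0\le t\le 1)$ that realizes $\gamma$ in an energy preserving manner, i.e. $X$ realizes $\gamma$ and $\mathcal{E}[X]=\mathcal{E}[\gamma]$.
   Context: $\mathcal{M}(K)$ is the space of Borel probability measures on $K$ with the 2-Wasserstein distance $W(\mu,\nu)^2=\inf\mathbb{E}[d(V,V')^2]$, the infimum being over couplings $(V,V')$ with $V\sim\mu$, $V'\sim\nu$. A path in a metric space is a continuous map from $[0,1]$ into it. The energy of $\gamma$ is $$\mathcal{E}[\gamma]=\sup_\Pi\sum_{i=1}^n\frac{W(\gamma(t_i),\gamma(t_{i-1}))^2}{t_i-t_{i-1}},$$ and the energy of a $K$-valued process $X$ is taken with respect to the $L^2$ metric: $$\mathcal{E}[X]=\sup_\Pi\sum_{i=1}^n\frac{\mathbb{E}[d(X(t_i),X(t_{i-1}))^2]}{t_i-t_{i-1}},$$ both suprema being over all finite partitions $\Pi=\{0=t_0<t_1<\cdots<t_n=1\}$ of $[0,1]$. A $K$-valued stochastic process $X=(X(t);0\le t\le1)$ realizes $\gamma$ if (1) $X(t)\sim\gamma(t)$ for every $t$, and (2) $X$ has continuous sample paths almost surely. *)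

theory Defs
  imports "HOL-Probability.Probability"
begin

class compact_metric_space = metric_space +
  assumes compact_UNIV_metric: "compact UNIV"

instance compact_metric_space \<subseteq> polish_space
proof
  fix X :: "nat \<Rightarrow> 'a"
  assume "Cauchy X"
  then show "convergent X"
    using compact_imp_complete[OF compact_UNIV_metric]
    by (auto simp: complete_def convergent_def)
next
  have "\<exists>k::'a set. finite k \<and> UNIV \<subseteq> (\<Union>x\<in>k. ball x (1 / Suc n))" for n :: nat
    using compact_UNIV_metric[where ?'a = 'a] unfolding compact_eq_totally_bounded by simp
  then obtain k :: "nat \<Rightarrow> 'a set"
    where k: "\<And>n. finite (k n)" "\<And>n. UNIV \<subseteq> (\<Union>x\<in>k n. ball x (1 / Suc n))"
    by metis
  define B where "B = (\<Union>n. (\<lambda>x. ball x (1 / real (Suc n))) ` k n)"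
  have "topological_basis B"
  proof (rule topological_basisI)
    fix U assume "U \<in> B"
    then show "open U" by (auto simp: B_def)
  next
    fix U :: "'a set" and x assume "open U" "x \<in> U"
    then obtain e where e: "e > 0" "ball x e \<subseteq> U" by (auto simp: open_contains_ball)
    obtain n where n: "1 / real (Suc n) < e / 2"
      using e(1) nat_approx_posE[of "e / 2"] by auto
    obtain y where y: "y \<in> k n" "dist y x < 1 / Suc n"
      using k(2)[of n] by (auto simp: subset_iff)
    have "ball y (1 / Suc n) \<subseteq> ball x e"
    proof
      fix z assume "z \<in> ball y (1 / Suc n)"
      then show "z \<in> ball x e"
        using y(2) n dist_triangle[of x z y] by (simp add: dist_commute)
    qed
    with e(2) y show "\<exists>V\<in>B. x \<in> V \<and> V \<subseteq> U"
      by (intro bexI[of _ "ball y (1 / Suc n)"]) (auto simp: B_def)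
  qed
  moreover have "countable B"
    unfolding B_def by (intro countable_UN countable_image countable_finite[OF k(1)]) auto
  ultimately show "\<exists>B::'a set set. countable B \<and> open = generate_topology B"
    by (auto intro: topological_basis_imp_subbasis)
qed

text \<open>A coupling of two measures is represented by the joint law of the pair \<open>(V, V')\<close>.\<close>

definition couplings :: "'a::topological_space measure \<Rightarrow> 'a measure \<Rightarrow> ('a \<times> 'a) measure set"
  where "couplings \<mu> \<nu> =
    {\<pi> \<in> space (prob_algebra (borel \<Otimes>\<^sub>M borel)). distr \<pi> borel fst = \<mu> \<and> distr \<pi> borel snd = \<nu>}"

text \<open>On a compact metric space the squared distance is bounded, so all the integrals below exist;
  the infimum is over a nonempty set, which contains the product coupling.\<close>

definition wasserstein :: "'a::compact_metric_space measure \<Rightarrow> 'a measure \<Rightarrow> real"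
  where "wasserstein \<mu> \<nu> =
    sqrt (INF \<pi>\<in>couplings \<mu> \<nu>. \<integral>p. (dist (fst p) (snd p))\<^sup>2 \<partial>\<pi>)"

definition L2_dist :: "'w measure \<Rightarrow> ('w \<Rightarrow> 'a::compact_metric_space) \<Rightarrow> ('w \<Rightarrow> 'a) \<Rightarrow> real"
  where "L2_dist M X Y = sqrt (\<integral>\<omega>. (dist (X \<omega>) (Y \<omega>))\<^sup>2 \<partial>M)"

definition unit_partition :: "nat \<Rightarrow> (nat \<Rightarrow> real) \<Rightarrow> bool"
  where "unit_partition n t \<longleftrightarrow> t 0 = 0 \<and> t n = 1 \<and> (\<forall>i\<in>{1..n}. t (i - 1) < t i)"

text \<open>The metric is a parameter, so that the same notion applies to paths of measures (with the
  Wasserstein distance) and to processes (with the \<open>L\<^sup>2\<close> distance).\<close>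

definition energy :: "('b \<Rightarrow> 'b \<Rightarrow> real) \<Rightarrow> (real \<Rightarrow> 'b) \<Rightarrow> ennreal"
  where "energy D f = (SUP (n, t)\<in>{(n, t). unit_partition n t}.
    ennreal (\<Sum>i=1..n. (D (f (t i)) (f (t (i - 1))))\<^sup>2 / (t i - t (i - 1))))"

definition wasserstein_path :: "(real \<Rightarrow> 'a::compact_metric_space measure) \<Rightarrow> bool"
  where "wasserstein_path \<gamma> \<longleftrightarrow>
    pathin (Metric_space.mtopology (space (prob_algebra borel)) wasserstein) \<gamma>"

text \<open>A sample space of type \<open>real \<Rightarrow> 'a\<close> suffices for existence statements: a process with
  almost surely continuous paths becomes one with continuous paths after a change on a null set,
  and can then be transported to its path space.\<close>

definition realizes ::
    "'w measure \<Rightarrow> (real \<Rightarrow> 'w \<Rightarrow> 'a::topological_space) \<Rightarrow> (real \<Rightarrow> 'a measure) \<Rightarrow> bool"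
  where "realizes M X \<gamma> \<longleftrightarrow>
    (\<forall>t\<in>{0..1}. X t \<in> borel_measurable M \<and> distr M borel (X t) = \<gamma> t) \<and>
    (AE \<omega> in M. continuous_on {0..1} (\<lambda>t. X t \<omega>))"

end

(* Near-optimal couplings between consecutive dyadic times are glued to a Markov chain; a weak limit
   P of these chains lives on K^Q, has the right marginals at dyadic times, and the expected level-n
   dyadic energy 2^n * sum_i d(X(i/2^n), X((i-1)/2^n))^2 is at most the energy of the path. By
   Cauchy-Schwarz these dyadic energies increase with n for every sample path, so monotone convergence
   makes their supremum S finite almost surely. Then d(X s, X t)^2 <= |t - s| * S at dyadic times, so
   X extends to a 1/2-Hoelder path on [0,1]; its energy is bounded by the dyadic ones, and from below
   because the law of (X s, X t) is a coupling.

   Disintegration is avoided: conditioning a coupling on the cell of its second coordinate in a fine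
   finite partition gives a kernel that transports the marginals exactly, at slightly higher cost. *)

theory Submission
  imports Defs
begin

text \<open>The chains of different levels are chosen independently of each other, so their laws
  need not agree on common times and no projective limit can be formed; compactness of the path
  space takes its place. What survives a weak limit are statements tested by continuous functions of
  finitely many coordinates: the one-dimensional laws, and bounds on the expected dyadic energy of a
  fixed level. Monotonicity in the level hands the bound for level n down to each level m <= n, so
  every fixed level inherits it. The error allowed per step is 8^-n: level n has 2^n steps, each
  divided by the mesh 2^-n, so the total error is 4^n times 8^-n, which is 2^-n. A formal obstacle:
  outside the probability measures \<open>wasserstein\<close> takes the value
  \<open>sqrt (Inf {})\<close>, and the real number \<open>Inf {}\<close> is unspecified. Hence
  continuity of the path yields that its values are probability measures only if the metric axioms
  can be established, and the finite energy has to settle the remaining case.\<close>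

subsection \<open>Weak sequential compactness\<close>

text \<open>The first differing digit, at position m, contributes 4^-m, and all later digits
  together at most 4^-m / 3, so the difference stays above 4^-m / 2. Base 4 matters: in base 2 the
  tail could cancel the leading difference.\<close>

lemma binary_series_separation:
  fixes b b' :: "nat \<Rightarrow> real"
  assumes b: "\<And>i. b i \<in> {0, 1}" "\<And>i. b' i \<in> {0, 1}" and k: "k \<le> N" "b k \<noteq> b' k"
  shows "1 / (2 * 4 ^ N) < \<bar>(\<Sum>i. b i / 4 ^ i) - (\<Sum>i. b' i / 4 ^ i)\<bar>"
proof -
  define c where "c i = b i - b' i" for i
  define m where "m = (LEAST i. c i \<noteq> 0)"
  have cm: "c m \<noteq> 0" and mk: "m \<le> k"
    using k(2) LeastI[of "\<lambda>i. c i \<noteq> 0" k] Least_le[of "\<lambda>i. c i \<noteq> 0" k] by (auto simp: m_def c_def)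
  have c0: "c i = 0" if "i < m" for i
    using not_less_Least[of i "\<lambda>i. c i \<noteq> 0"] that by (auto simp: m_def)
  have c1: "\<bar>c i\<bar> \<le> 1" for i using b(1)[of i] b(2)[of i] by (auto simp: c_def)
  have cm1: "\<bar>c m\<bar> = 1" using b(1)[of m] b(2)[of m] cm by (auto simp: c_def)
  have geo: "summable (\<lambda>i. (1::real) / 4 ^ i)"
    using summable_geometric[of "1/4::real"] by (simp add: power_one_over)
  have sm: "summable (\<lambda>i. d i / 4 ^ i)" if "\<And>i. \<bar>d i\<bar> \<le> 1" for d :: "nat \<Rightarrow> real"
    by (rule summable_comparison_test'[OF geo, of 0]) (use that in \<open>auto simp: divide_simps\<close>)
  have "\<bar>b i\<bar> \<le> 1" "\<bar>b' i\<bar> \<le> 1" for i using b(1)[of i] b(2)[of i] by auto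
  then have smb: "summable (\<lambda>i. b i / 4 ^ i)" "summable (\<lambda>i. b' i / 4 ^ i)" by (auto intro!: sm)
  have smc: "summable (\<lambda>i. c i / 4 ^ i)" by (rule sm[OF c1])
  have "(\<Sum>i. b i / 4 ^ i) - (\<Sum>i. b' i / 4 ^ i) = (\<Sum>i. c i / 4 ^ i)"
    by (subst suminf_diff[OF smb]) (simp add: c_def diff_divide_distrib)
  also have "\<dots> = (\<Sum>i. c (i + Suc m) / 4 ^ (i + Suc m)) + (\<Sum>i<Suc m. c i / 4 ^ i)"
    by (rule suminf_split_initial_segment[OF smc])
  also have "(\<Sum>i<Suc m. c i / 4 ^ i) = c m / 4 ^ m" using c0 by simp
  finally have eq: "(\<Sum>i. b i / 4 ^ i) - (\<Sum>i. b' i / 4 ^ i)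
      = (\<Sum>i. c (i + Suc m) / 4 ^ (i + Suc m)) + c m / 4 ^ m" .
  have gs: "(\<lambda>i. 1 / 4 ^ (i + Suc m)) sums (1 / 4 ^ Suc m * (4/3::real))"
  proof -
    have "(\<lambda>i. (1/4::real) ^ i) sums (1 / (1 - 1/4))" by (rule geometric_sums) simp
    from sums_mult[OF this, of "1 / 4 ^ Suc m"] show ?thesis
      by (simp add: power_one_over power_add field_simps)
  qed
  have "\<bar>\<Sum>i. c (i + Suc m) / 4 ^ (i + Suc m)\<bar> \<le> (\<Sum>i. 1 / 4 ^ (i + Suc m))"
    unfolding real_norm_def[symmetric]
    by (rule norm_suminf_le[OF _ sums_summable[OF gs]]) (use c1 in \<open>auto simp: divide_simps\<close>)
  also have "\<dots> = 1 / 4 ^ Suc m * (4/3)" using gs by (rule sums_unique[symmetric])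
  finally have "\<bar>\<Sum>i. c (i + Suc m) / 4 ^ (i + Suc m)\<bar> \<le> 1 / (3 * 4 ^ m)" by simp
  moreover have "\<bar>c m / 4 ^ m\<bar> = 1 / 4 ^ m" using cm1 by simp
  moreover have "1 / (2 * 4 ^ N) \<le> 1 / (2 * 4 ^ m :: real)"
    using mk k(1) by (intro divide_left_mono mult_left_mono power_increasing) auto
  moreover have "1 / (2 * 4 ^ m) < 1 / 4 ^ m - 1 / (3 * 4 ^ m :: real)" by (simp add: field_simps)
  ultimately show ?thesis unfolding eq by linarith
qed

text \<open>Basis sets of diameter below \<open>e\<close> cover the space, and finitely many of them
  suffice. Two points with the same membership pattern up to the largest index used lie in a common
  one of these sets.\<close>

lemma compact_separating_sequence:
  assumes "compact (UNIV :: 'b::{metric_space, second_countable_topology} set)"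
  obtains U :: "nat \<Rightarrow> 'b::{metric_space, second_countable_topology} set" where "\<And>i. open (U i)"
    "\<And>e. e > 0 \<Longrightarrow> \<exists>N. \<forall>y y'. (\<forall>i\<le>N. y \<in> U i \<longleftrightarrow> y' \<in> U i) \<longrightarrow> dist y y' < e"
proof -
  obtain B :: "'b set set" where B: "countable B" "topological_basis B"
    using ex_countable_basis by auto
  have ne: "B \<noteq> {}"
    using topological_basisE[OF B(2) open_UNIV UNIV_I] by blast
  define U where "U = from_nat_into B"
  have UB: "range U = B" using range_from_nat_into[OF ne B(1)] by (simp add: U_def)
  show ?thesis
  proof
    show "open (U i)" for i using UB topological_basis_open[OF B(2)] by blast
    fix e :: real assume e: "e > 0"
    define I where "I = {i. \<forall>y\<in>U i. \<forall>y'\<in>U i. dist y y' < e}"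
    have "UNIV \<subseteq> (\<Union>i\<in>I. U i)"
    proof
      fix x :: 'b
      obtain V where V: "V \<in> B" "x \<in> V" "V \<subseteq> ball x (e/2)"
        using topological_basisE[OF B(2), of "ball x (e/2)" x] e by auto
      obtain i where i: "V = U i" using V(1) UB by blast
      have "dist y y' < e" if "y \<in> U i" "y' \<in> U i" for y y'
        using that V(3) i dist_triangle_half_r[of x y e y'] by (auto simp: subset_iff)
      then show "x \<in> (\<Union>i\<in>I. U i)" using V(2) i by (auto simp: I_def)
    qed
    moreover have "open (U i)" for i using UB topological_basis_open[OF B(2)] by blast
    ultimately obtain J where J: "J \<subseteq> I" "finite J" "UNIV \<subseteq> (\<Union>i\<in>J. U i)"
      using compactE_image[OF assms, of I U] by metis
    have "dist y y' < e" if *: "\<forall>i\<le>Max J. y \<in> U i \<longleftrightarrow> y' \<in> U i" for y y'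
    proof -
      obtain i where i: "i \<in> J" "y \<in> U i" using J(3) by auto
      then have "i \<le> Max J" using J(2) by simp
      then show ?thesis using * i J(1) by (auto simp: I_def)
    qed
    then show "\<exists>N. \<forall>y y'. (\<forall>i\<le>N. y \<in> U i \<longleftrightarrow> y' \<in> U i) \<longrightarrow> dist y y' < e" by blast
  qed
qed

text \<open>The base-4 digits of \<open>s y\<close> record in which sets \<open>U i\<close> the
  point lies. Nearby codes share their first digits and so belong to nearby points: the inverse of
  \<open>s\<close> is uniformly continuous and extends to the closure of the range, although
  \<open>s\<close> itself is only Borel.\<close>

lemma compact_real_coding:
  assumes "compact (UNIV :: 'b::polish_space set)"
  obtains s :: "'b::polish_space \<Rightarrow> real" and g :: "real \<Rightarrow> 'b"
    where "s \<in> borel_measurable borel" "range s \<subseteq> {-1<..2}"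
      "continuous_on (closure (range s)) g" "\<And>y. g (s y) = y"
proof -
  obtain U :: "nat \<Rightarrow> 'b set" where U: "\<And>i. open (U i)"
    "\<And>e. e > 0 \<Longrightarrow> \<exists>N. \<forall>y y'. (\<forall>i\<le>N. y \<in> U i \<longleftrightarrow> y' \<in> U i) \<longrightarrow> dist y y' < e"
    using compact_separating_sequence[OF assms] by metis
  define s :: "'b \<Rightarrow> real" where "s y = (\<Sum>i. indicator (U i) y / 4 ^ i)" for y
  have sm: "summable (\<lambda>i. indicator (U i) y / 4 ^ i :: real)" and le: "s y \<le> 2" and ge: "0 \<le> s y" for y
  proof -
    have g: "(\<lambda>i. (1/4::real) ^ i) sums (1 / (1 - 1/4))" by (rule geometric_sums) simp
    show sm: "summable (\<lambda>i. indicator (U i) y / 4 ^ i :: real)"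
      by (rule summable_comparison_test'[OF sums_summable[OF g], of 0])
         (auto simp: power_one_over indicator_def)
    have "s y \<le> (\<Sum>i. (1/4) ^ i)" unfolding s_def
      by (intro suminf_le sm sums_summable[OF g]) (auto simp: power_one_over indicator_def)
    then show "s y \<le> 2" using sums_unique[OF g] by simp
    show "0 \<le> s y" unfolding s_def by (intro suminf_nonneg sm) auto
  qed
  have sep: "\<exists>d>0. \<forall>y y'. dist (s y) (s y') < d \<longrightarrow> dist y y' < e" if e: "e > 0" for e
  proof -
    obtain N where N: "\<And>y y'. (\<forall>i\<le>N. y \<in> U i \<longleftrightarrow> y' \<in> U i) \<Longrightarrow> dist y y' < e"
      using U(2)[OF e] by blast
    have "dist y y' < e" if "dist (s y) (s y') < 1 / (2 * 4 ^ N)" for y y'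
    proof (rule N, intro allI impI)
      fix i assume i: "i \<le> N"
      have "\<not> indicator (U i) y \<noteq> (indicator (U i) y' :: real)"
      proof
        assume "indicator (U i) y \<noteq> (indicator (U i) y' :: real)"
        then have "1 / (2 * 4 ^ N) < \<bar>s y - s y'\<bar>"
          unfolding s_def by (intro binary_series_separation[OF _ _ i]) (auto simp: indicator_def)
        then show False using that by (simp add: dist_real_def)
      qed
      then show "y \<in> U i \<longleftrightarrow> y' \<in> U i" by (auto simp: indicator_def split: if_splits)
    qed
    then show ?thesis by (intro exI[of _ "1 / (2 * 4 ^ N)"]) auto
  qed
  have inj: "inj s"
  proof (rule injI, rule ccontr)
    fix y y' assume "s y = s y'" "y \<noteq> y'"
    then show False using sep[of "dist y y'"] by (metis dist_self less_irrefl zero_less_dist_iff)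
  qed
  have "uniformly_continuous_on (range s) (inv s)"
    unfolding uniformly_continuous_on_def using sep inj by (auto simp: dist_commute)
  then obtain g where g: "uniformly_continuous_on (closure (range s)) g"
      "\<And>x. x \<in> range s \<Longrightarrow> inv s x = g x"
    using uniformly_continuous_on_extension_on_closure by metis
  show ?thesis
  proof
    show "s \<in> borel_measurable borel"
      unfolding s_def using U(1) by (auto intro!: borel_measurable_suminf borel_measurable_divide borel_measurable_indicator)
    \<comment> \<open>The lower bound is strict because \<open>tight\<close> is tested on half-open
      intervals.\<close>
    have "-1 < s y" for y using ge[of y] by linarith
    then show "range s \<subseteq> {-1<..2}" using le by auto
    show "continuous_on (closure (range s)) g"
      by (rule uniformly_continuous_imp_continuous[OF g(1)])
    show "g (s y) = y" for y using g(2)[of "s y"] inj by simp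
  qed
qed

text \<open>The measures are moved to the real line by an injective Borel code whose inverse is continuous;
  there Helly's theorem applies.\<close>

lemma weak_seq_compact:
  fixes \<mu> :: "nat \<Rightarrow> 'b::polish_space measure"
  assumes cpt: "compact (UNIV :: 'b set)" and \<mu>: "\<And>n. \<mu> n \<in> space (prob_algebra borel)"
  obtains r \<nu> where "strict_mono r" "\<nu> \<in> space (prob_algebra borel)"
    "\<And>f :: 'b \<Rightarrow> real. continuous_on UNIV f \<Longrightarrow>
      (\<lambda>k. \<integral>x. f x \<partial>\<mu> (r k)) \<longlonglongrightarrow> (\<integral>x. f x \<partial>\<nu>)"
proof -
  obtain s :: "'b \<Rightarrow> real" and g where s[measurable]: "s \<in> borel_measurable borel"
    and rs: "range s \<subseteq> {-1<..2}" and g: "continuous_on (closure (range s)) g" and gs: "\<And>y. g (s y) = y"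
    using compact_real_coding[OF cpt] by metis
  define C where "C = closure (range s)"
  have C: "closed C" "C \<noteq> {}" "range s \<subseteq> C" by (auto simp: C_def closure_subset[THEN subsetD])
  have [measurable_cong, simp]: "sets (\<mu> n) = sets borel" and p\<mu>: "prob_space (\<mu> n)" for n
    using \<mu>[of n] by (auto simp: space_prob_algebra)
  have [simp]: "space (\<mu> n) = UNIV" for n by (metis \<open>\<And>n. sets (\<mu> n) = sets borel\<close> sets_eq_imp_space_eq space_borel)
  define \<rho> where "\<rho> n = distr (\<mu> n) borel s" for n
  have sm: "s \<in> borel_measurable (\<mu> n)" for n by simp
  have rd: "real_distribution (\<rho> n)" for n
    unfolding real_distribution_def real_distribution_axioms_def \<rho>_def
    using prob_space.prob_space_distr[OF p\<mu> sm] by auto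
  have "tight \<rho>"
    unfolding tight_def
  proof (intro conjI allI impI rd)
    fix e :: real assume "e > 0"
    have "measure (\<rho> n) {-1<..2} = 1" for n
    proof -
      have "s -` {-1<..2} = UNIV" using rs by auto
      then show ?thesis using prob_space.prob_space[OF p\<mu>, of n] by (simp add: \<rho>_def measure_distr)
    qed
    then show "\<exists>a b. a < b \<and> (\<forall>n. 1 - e < measure (\<rho> n) {a<..b})"
      using \<open>e > 0\<close> by (intro exI[of _ "-1"] exI[of _ 2]) auto
  qed
  then obtain r M where r: "strict_mono r" and M: "real_distribution M"
    and wc: "weak_conv_m (\<rho> \<circ> id \<circ> r) M"
    using tight_imp_convergent_subsubsequence[of \<rho> id] by (auto simp: strict_mono_def)
  interpret M: real_distribution M by fact
  have conv: "(\<lambda>n. integral\<^sup>L (\<rho> (r n)) f) \<longlonglongrightarrow> integral\<^sup>L M f"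
    if "continuous_on UNIV f" "\<And>x. norm (f x) \<le> B" for f :: "real \<Rightarrow> real" and B
    using weak_conv_imp_integral_bdd_continuous_conv[OF _ M wc, of f B] rd that
    by (auto simp: continuous_on_eq_continuous_at)
  have int_s: "integral\<^sup>L (\<rho> n) f = (\<integral>x. f (s x) \<partial>\<mu> n)" if "f \<in> borel_measurable borel"
    for f :: "real \<Rightarrow> real" and n
    unfolding \<rho>_def using that by (simp add: integral_distr)
  \<comment> \<open>A bounded continuous function that vanishes exactly on \<open>C\<close>. Its
    integrals under all \<rho> n are 0, hence also the one under the limit, which is therefore
    concentrated on \<open>C\<close>.\<close>
  define h where "h x = min 1 (infdist x C)" for x
  have hc: "continuous_on UNIV h" unfolding h_def by (intro continuous_intros)
  have h0: "0 \<le> h x" "norm (h x) \<le> 1" "h x \<le> 1" for x by (auto simp: h_def infdist_nonneg)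
  have [measurable]: "h \<in> borel_measurable borel" by (rule borel_measurable_continuous_onI[OF hc])
  have "integral\<^sup>L (\<rho> n) h = 0" for n
  proof -
    have "s x \<in> C" for x using C(3) by blast
    then have "h (s x) = 0" for x by (simp add: h_def)
    then show ?thesis by (subst int_s) auto
  qed
  then have "integral\<^sup>L M h = 0"
    using conv[OF hc h0(2)] by (simp add: LIMSEQ_const_iff)
  then have "AE x in M. h x = 0"
    by (subst (asm) integral_nonneg_eq_0_iff_AE) (auto simp: h0 intro!: M.integrable_const_bound[where B=1])
  then have AEC: "AE x in M. x \<in> C"
    by eventually_elim (use C in \<open>auto simp: h_def min_def in_closed_iff_infdist_zero split: if_splits\<close>)
  \<comment> \<open>The decoding map; the default value is taken on an \<open>M\<close>-null set
    only.\<close>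
  define \<phi> where "\<phi> x = (if x \<in> C then g x else undefined)" for x
  have \<phi>[measurable]: "\<phi> \<in> borel_measurable borel"
    unfolding \<phi>_def by (rule borel_measurable_continuous_on_if) (use g C in \<open>auto simp: C_def\<close>)
  show ?thesis
  proof (rule that[of r "distr M borel \<phi>"])
    show "strict_mono r" by fact
    show "distr M borel \<phi> \<in> space (prob_algebra borel)"
      by (auto simp: space_prob_algebra intro!: M.prob_space_distr)
    fix f :: "'b \<Rightarrow> real" assume f: "continuous_on UNIV f"
    then have [measurable]: "f \<in> borel_measurable borel" by (rule borel_measurable_continuous_onI)
    have "bounded (range f)" using compact_continuous_image[OF f cpt] by (rule compact_imp_bounded)
    then obtain B where B: "\<And>y. norm (f y) \<le> B" by (auto simp: bounded_iff)
    \<comment> \<open>The decoded test function is continuous on the closed set \<open>C\<close>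
      only. Tietze extends it to the line with the same bound, and there the weak convergence
      applies.\<close>
    have "continuous_on C (\<lambda>x. f (g x))"
      unfolding C_def by (rule continuous_on_compose2[where t=UNIV and f=g, OF f g]) simp
    moreover have "closedin (top_of_set UNIV) C" unfolding subtopology_UNIV closed_closedin[symmetric] by (rule C(1))
    moreover have "0 \<le> B" using norm_ge_zero B by (rule order_trans)
    ultimately obtain F where F: "continuous_on UNIV F" "\<And>x. x \<in> C \<Longrightarrow> F x = f (g x)" "\<And>x. norm (F x) \<le> B"
      by (rule Tietze[where f="\<lambda>x. f (g x)"]) (use B in auto)
    have [measurable]: "F \<in> borel_measurable borel" by (rule borel_measurable_continuous_onI[OF F(1)])
    have "integral\<^sup>L (\<rho> n) F = (\<integral>x. f x \<partial>\<mu> n)" for n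
    proof -
      have "F (s x) = f x" for x using F(2)[of "s x"] C gs by auto
      then show ?thesis by (subst int_s) auto
    qed
    moreover have "integral\<^sup>L M F = (\<integral>x. f x \<partial>distr M borel \<phi>)"
    proof -
      have "(\<integral>x. f x \<partial>distr M borel \<phi>) = (\<integral>x. f (\<phi> x) \<partial>M)" by (rule integral_distr) measurable
      also have "\<dots> = integral\<^sup>L M F"
      proof (rule integral_cong_AE)
        show "AE x in M. f (\<phi> x) = F x"
          using AEC by eventually_elim (simp add: \<phi>_def F(2))
      qed measurable
      finally show ?thesis by simp
    qed
    ultimately show "(\<lambda>k. \<integral>x. f x \<partial>\<mu> (r k)) \<longlonglongrightarrow> (\<integral>x. f x \<partial>distr M borel \<phi>)"
      using conv[OF F(1,3)] by simp
  qed
qed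

text \<open>Tychonoff's theorem. With a countable index type the product is also Polish, as
  \<open>weak_seq_compact\<close> requires of its space.\<close>

lemma compact_UNIV_fun: "compact (UNIV :: ('i::countable \<Rightarrow> 'a::compact_metric_space) set)"
proof -
  have "compact_space (euclidean :: 'a topology)"
    using compact_UNIV_metric[where 'a='a] by (simp add: compact_space_def)
  then have "compact_space (product_topology (\<lambda>_::'i. euclidean :: 'a topology) UNIV)"
    unfolding compact_space_product_topology by auto
  then show ?thesis
    by (simp add: compact_space_def euclidean_product_topology)
qed

subsection \<open>Couplings and the Wasserstein distance\<close>

lemma compact_metric_bounded:
  obtains D :: real where "D > 0" "\<And>x y :: 'a::compact_metric_space. dist x y \<le> D"
proof -
  have "bounded (UNIV :: 'a set)" by (rule compact_imp_bounded[OF compact_UNIV_metric])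
  then obtain x e where "\<forall>y::'a. dist x y \<le> e" by (auto simp: bounded_def)
  then have "dist y z \<le> max 1 (2 * e)" for y z :: 'a
    using dist_triangle3[of y z x] by (smt (verit))
  then show ?thesis using that[of "max 1 (2 * e)"] by auto
qed

text \<open>The indicator of an open set is the limit of the functions
  \<open>min 1 (Suc n * infdist x (-U))\<close>, which are Lipschitz with values in the unit
  interval, and the open sets are an intersection-stable generator. Lipschitz test functions are the
  right class here because the Wasserstein distance controls their integrals.\<close>

lemma measure_eqI_lipschitz:
  fixes \<mu> \<nu> :: "'a::metric_space measure"
  assumes \<mu>: "\<mu> \<in> space (prob_algebra borel)" and \<nu>: "\<nu> \<in> space (prob_algebra borel)"
    and eq: "\<And>(f :: 'a \<Rightarrow> real) L. L > 0 \<Longrightarrow> (\<And>x y. \<bar>f x - f y\<bar> \<le> L * dist x y) \<Longrightarrow>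
      (\<And>x. f x \<in> {0..1}) \<Longrightarrow> (\<integral>x. f x \<partial>\<mu>) = (\<integral>x. f x \<partial>\<nu>)"
  shows "\<mu> = \<nu>"
proof -
  interpret M: prob_space \<mu> using \<mu> by (simp add: space_prob_algebra)
  interpret N: prob_space \<nu> using \<nu> by (simp add: space_prob_algebra)
  have [measurable_cong, simp]: "sets \<mu> = sets borel" "sets \<nu> = sets borel"
    using \<mu> \<nu> by (auto simp: space_prob_algebra)
  have [simp]: "space \<mu> = UNIV" "space \<nu> = UNIV"
    by (metis \<open>sets \<mu> = sets borel\<close> \<open>sets \<nu> = sets borel\<close> sets_eq_imp_space_eq space_borel)+
  have open_eq: "measure \<mu> U = measure \<nu> U" if U: "open U" for U
  \<comment> \<open>The whole space is treated apart because \<open>infdist\<close> to the empty set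
    is 0 by convention.\<close>
  proof (cases "U = UNIV")
    case True
    then show ?thesis using M.prob_space N.prob_space by simp
  next
    case False
    define f where "f n x = min 1 (real (Suc n) * infdist x (-U))" for n x
    have lip: "\<bar>f n x - f n y\<bar> \<le> real (Suc n) * dist x y" for n x y
    proof -
      have "\<bar>f n x - f n y\<bar> \<le> \<bar>real (Suc n) * infdist x (-U) - real (Suc n) * infdist y (-U)\<bar>"
        by (auto simp: f_def)
      also have "\<dots> = real (Suc n) * \<bar>infdist x (-U) - infdist y (-U)\<bar>"
        by (subst right_diff_distrib[symmetric]) (simp only: abs_mult abs_of_nat)
      also have "\<dots> \<le> real (Suc n) * dist x y"
        by (intro mult_left_mono infdist_triangle_abs) auto
      finally show ?thesis .
    qed
    have f01: "f n x \<in> {0..1}" for n x by (auto simp: f_def infdist_nonneg)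
    have f1: "norm (f n x) \<le> 1" for n x using f01[of n x] by auto
    have "continuous_on UNIV (f n)" for n unfolding f_def by (intro continuous_intros)
    then have [measurable]: "f n \<in> borel_measurable borel" for n by (rule borel_measurable_continuous_onI)
    have fl: "(\<lambda>n. f n x) \<longlonglongrightarrow> indicator U x" for x
    proof (cases "x \<in> U")
      case True
      have "infdist x (-U) \<noteq> 0"
        using in_closed_iff_infdist_zero[of "-U" x] U False True by auto
      then have p: "infdist x (-U) > 0" using infdist_nonneg[of x "-U"] by linarith
      then obtain N where N: "1 < real N * infdist x (-U)" using reals_Archimedean3 by blast
      have "f n x = 1" if "n \<ge> N" for n
      proof -
        have "real N * infdist x (-U) \<le> real (Suc n) * infdist x (-U)"
          using that p by (intro mult_right_mono) auto
        then show ?thesis using N unfolding f_def by linarith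
      qed
      then have "eventually (\<lambda>n. f n x = 1) sequentially" by (auto simp: eventually_sequentially)
      then show ?thesis using True by (simp add: tendsto_eventually)
    next
      case False
      then have "f n x = 0" for n by (simp add: f_def infdist_zero)
      then show ?thesis using False by simp
    qed
    have UU [measurable]: "U \<in> sets borel" using U by simp
    have lim: "(\<lambda>n. \<integral>x. f n x \<partial>Q) \<longlonglongrightarrow> measure Q U" if "prob_space Q" "sets Q = sets borel" for Q
    proof -
      interpret Q: prob_space Q by fact
      have [measurable_cong]: "sets Q = sets borel" by fact
      have "(\<lambda>n. \<integral>x. f n x \<partial>Q) \<longlonglongrightarrow> (\<integral>x. indicator U x \<partial>Q)"
        by (rule integral_dominated_convergence[where w="\<lambda>_. 1"]) (use fl f1 in auto)
      moreover have "U \<inter> space Q = U" using sets_eq_imp_space_eq[OF that(2)] by simp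
      ultimately show ?thesis by simp
    qed
    have "(\<integral>x. f n x \<partial>\<mu>) = (\<integral>x. f n x \<partial>\<nu>)" for n
      by (rule eq[of "real (Suc n)"]) (use lip f01 in auto)
    then show ?thesis
      using lim[OF M.prob_space_axioms] lim[OF N.prob_space_axioms] by (auto intro: LIMSEQ_unique)
  qed
  show ?thesis
  proof (rule measure_eqI_generator_eq[where E="{S. open S}" and \<Omega>=UNIV and A="\<lambda>_. UNIV"])
    show "Int_stable {S :: 'a set. open S}" by (auto simp: Int_stable_def)
    show "sets \<mu> = sigma_sets UNIV {S. open S}" "sets \<nu> = sigma_sets UNIV {S. open S}"
      by (simp_all add: borel_def)
  qed (auto simp: M.emeasure_eq_measure N.emeasure_eq_measure open_eq)
qed

definition transport_cost :: "('a::compact_metric_space \<times> 'a) measure \<Rightarrow> real" where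
  "transport_cost \<pi> = (\<integral>p. (dist (fst p) (snd p))\<^sup>2 \<partial>\<pi>)"

lemma couplingsD:
  fixes \<pi> :: "('a::compact_metric_space \<times> 'a) measure"
  assumes "\<pi> \<in> couplings \<mu> \<nu>"
  shows "prob_space \<pi>" "sets \<pi> = sets (borel \<Otimes>\<^sub>M borel)" "space \<pi> = UNIV"
    "distr \<pi> borel fst = \<mu>" "distr \<pi> borel snd = \<nu>"
proof -
  show "prob_space \<pi>" "distr \<pi> borel fst = \<mu>" "distr \<pi> borel snd = \<nu>"
    and *: "sets \<pi> = sets (borel \<Otimes>\<^sub>M borel)"
    using assms by (auto simp: couplings_def space_prob_algebra)
  show "space \<pi> = UNIV" using sets_eq_imp_space_eq[OF *] by (simp add: space_pair_measure)
qed

lemma distr_pair_in_couplings: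
  fixes X Y :: "'w \<Rightarrow> 'a::compact_metric_space"
  assumes "prob_space M" and [measurable]: "X \<in> borel_measurable M" "Y \<in> borel_measurable M"
  shows "distr M (borel \<Otimes>\<^sub>M borel) (\<lambda>w. (X w, Y w)) \<in> couplings (distr M borel X) (distr M borel Y)"
  by (auto simp: couplings_def space_prob_algebra distr_distr comp_def
      intro!: prob_space.prob_space_distr[OF assms(1)])

text \<open>\<open>sqrt\<close> is an odd function on all reals, so squaring it gives an absolute
  value. It cannot be dropped here: without couplings the infimum is an unspecified real.\<close>

lemma wasserstein_sq:
  fixes \<mu> \<nu> :: "'a::compact_metric_space measure"
  shows "(wasserstein \<mu> \<nu>)\<^sup>2 = \<bar>INF \<pi>\<in>couplings \<mu> \<nu>. transport_cost \<pi>\<bar>"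
  unfolding wasserstein_def transport_cost_def by (simp add: real_sqrt_abs2 power2_eq_square real_sqrt_mult[symmetric])

lemma bdd_below_cost: "bdd_below (transport_cost ` S)"
  by (rule bdd_belowI2[of _ 0]) (simp add: transport_cost_def)

lemma couplings_nonempty:
  fixes \<mu> \<nu> :: "'a::compact_metric_space measure"
  assumes "\<mu> \<in> space (prob_algebra borel)" "\<nu> \<in> space (prob_algebra borel)"
  shows "couplings \<mu> \<nu> \<noteq> {}"
proof -
  have ps: "prob_space \<mu>" "prob_space \<nu>" and st: "sets \<mu> = sets borel" "sets \<nu> = sets borel"
    using assms by (auto simp: space_prob_algebra)
  interpret pair_prob_space \<mu> \<nu> using ps by (simp add: pair_prob_space_def pair_sigma_finite_def prob_space_imp_sigma_finite)
  have P: "prob_space (\<mu> \<Otimes>\<^sub>M \<nu>)" by unfold_locales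
  have "distr (\<mu> \<Otimes>\<^sub>M \<nu>) (borel \<Otimes>\<^sub>M borel) (\<lambda>w. (fst w, snd w)) \<in>
      couplings (distr (\<mu> \<Otimes>\<^sub>M \<nu>) borel fst) (distr (\<mu> \<Otimes>\<^sub>M \<nu>) borel snd)"
    by (rule distr_pair_in_couplings[OF P]) (use st in \<open>auto cong: measurable_cong_sets\<close>)
  moreover have "distr (\<mu> \<Otimes>\<^sub>M \<nu>) borel fst = \<mu>"
  proof -
    have "distr (\<mu> \<Otimes>\<^sub>M \<nu>) borel fst = distr (\<mu> \<Otimes>\<^sub>M \<nu>) \<mu> fst" by (rule distr_cong) (use st in auto)
    also have "\<dots> = \<mu>" by (rule M2.distr_pair_fst)
    finally show ?thesis .
  qed
  moreover have "distr (\<mu> \<Otimes>\<^sub>M \<nu>) borel snd = \<nu>"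
  proof -
    \<comment> \<open>Swapping the factors reduces the second marginal to the first.\<close>
    have "distr (\<mu> \<Otimes>\<^sub>M \<nu>) borel snd = distr (distr (\<nu> \<Otimes>\<^sub>M \<mu>) (\<mu> \<Otimes>\<^sub>M \<nu>) (\<lambda>(x, y). (y, x))) \<nu> snd"
      by (subst distr_pair_swap[symmetric], rule distr_cong) (use st in auto)
    also have "\<dots> = distr (\<nu> \<Otimes>\<^sub>M \<mu>) \<nu> fst"
      by (subst distr_distr) (auto simp: comp_def case_prod_beta')
    also have "\<dots> = \<nu>" by (rule M1.distr_pair_fst)
    finally show ?thesis .
  qed
  ultimately show ?thesis by auto
qed

lemma wasserstein_sq_le_cost:
  assumes "\<pi> \<in> couplings \<mu> \<nu>"
  shows "(wasserstein \<mu> \<nu>)\<^sup>2 \<le> transport_cost \<pi>"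
proof -
  have "(INF \<pi>\<in>couplings \<mu> \<nu>. transport_cost \<pi>) \<ge> 0"
    using assms by (intro cINF_greatest) (auto simp: transport_cost_def)
  then show ?thesis
    unfolding wasserstein_sq using cINF_lower[OF bdd_below_cost assms] by simp
qed

lemma near_optimal_coupling:
  assumes "\<mu> \<in> space (prob_algebra borel)" "\<nu> \<in> space (prob_algebra borel)" "e > 0"
  obtains \<pi> where "\<pi> \<in> couplings \<mu> \<nu>" "transport_cost \<pi> < (wasserstein \<mu> \<nu>)\<^sup>2 + e"
proof -
  have "(INF \<pi>\<in>couplings \<mu> \<nu>. transport_cost \<pi>) < (wasserstein \<mu> \<nu>)\<^sup>2 + e"
    using assms(3) by (simp add: wasserstein_sq)
  then show ?thesis
    using that by (auto simp: cINF_less_iff[OF couplings_nonempty[OF assms(1,2)] bdd_below_cost])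
qed

lemma integrable_bounded_dist:
  fixes X Y :: "'w \<Rightarrow> 'a::compact_metric_space"
  assumes "prob_space M" and [measurable]: "X \<in> borel_measurable M" "Y \<in> borel_measurable M"
  shows "integrable M (\<lambda>w. dist (X w) (Y w) ^ k)"
proof -
  obtain D where D: "D > 0" "\<And>x y :: 'a. dist x y \<le> D" using compact_metric_bounded[where 'a='a] by blast
  interpret prob_space M by fact
  show ?thesis
    by (rule integrable_const_bound[of _ "D ^ k"]) (auto intro!: AE_I2 power_mono D)
qed

lemma wasserstein_le_L2_dist:
  fixes X Y :: "'w \<Rightarrow> 'a::compact_metric_space"
  assumes "prob_space M" and [measurable]: "X \<in> borel_measurable M" "Y \<in> borel_measurable M"
  shows "wasserstein (distr M borel X) (distr M borel Y) \<le> L2_dist M X Y"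
proof -
  have "(wasserstein (distr M borel X) (distr M borel Y))\<^sup>2 \<le> (\<integral>w. (dist (X w) (Y w))\<^sup>2 \<partial>M)"
    using wasserstein_sq_le_cost[OF distr_pair_in_couplings[OF assms]]
    by (simp add: transport_cost_def integral_distr)
  then show ?thesis unfolding L2_dist_def by (rule real_le_rsqrt)
qed

lemma wasserstein_nonneg: 
  fixes \<mu> \<nu> :: "'a::compact_metric_space measure"
  assumes "\<mu> \<in> space (prob_algebra borel)" "\<nu> \<in> space (prob_algebra borel)"
  shows "0 \<le> wasserstein \<mu> \<nu>"
proof -
  have "(INF \<pi>\<in>couplings \<mu> \<nu>. transport_cost \<pi>) \<ge> 0"
    using couplings_nonempty[OF assms] by (intro cINF_greatest) (auto simp: transport_cost_def)
  then show ?thesis by (simp add: wasserstein_def transport_cost_def)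
qed

text \<open>The easy half of Kantorovich-Rubinstein duality, combined with the comparison of first
  and second moments: under every coupling the left side is at most \<open>L\<close> times the
  expected distance. A coupling within \<open>e\<close> of the infimum is used, then
  \<open>e\<close> tends to 0.\<close>

lemma lipschitz_integral_diff_le_wasserstein:
  fixes \<mu> \<nu> :: "'a::compact_metric_space measure" and f :: "'a \<Rightarrow> real"
  assumes \<mu>: "\<mu> \<in> space (prob_algebra borel)" and \<nu>: "\<nu> \<in> space (prob_algebra borel)"
    and L: "L > 0" and f: "\<And>x y. \<bar>f x - f y\<bar> \<le> L * dist x y"
  shows "\<bar>(\<integral>x. f x \<partial>\<mu>) - (\<integral>x. f x \<partial>\<nu>)\<bar> \<le> L * wasserstein \<mu> \<nu>"
proof -
  let ?a = "(\<integral>x. f x \<partial>\<mu>) - (\<integral>x. f x \<partial>\<nu>)"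
  obtain D where D: "D > 0" "\<And>x y :: 'a. dist x y \<le> D" using compact_metric_bounded[where 'a='a] by blast
  have "continuous_on UNIV f"
    using f L by (intro lipschitz_on_continuous_on[of L] lipschitz_onI) (auto simp: dist_real_def)
  then have fm[measurable]: "f \<in> borel_measurable borel" by (rule borel_measurable_continuous_onI)
  have "?a\<^sup>2 / L\<^sup>2 \<le> (wasserstein \<mu> \<nu>)\<^sup>2 + e" if e: "e > 0" for e
  proof -
    obtain \<pi> where \<pi>: "\<pi> \<in> couplings \<mu> \<nu>" "transport_cost \<pi> < (wasserstein \<mu> \<nu>)\<^sup>2 + e"
      using near_optimal_coupling[OF \<mu> \<nu> e] .
    note c = couplingsD[OF \<pi>(1)]
    interpret P: prob_space \<pi> by (rule c(1))
    have [measurable_cong]: "sets \<pi> = sets (borel \<Otimes>\<^sub>M borel)" by (rule c(2))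
    define u where "u p = dist (fst p) (snd p)" for p :: "'a \<times> 'a"
    have um[measurable]: "u \<in> borel_measurable (borel \<Otimes>\<^sub>M borel)" unfolding u_def by measurable
    have iu: "integrable \<pi> u" "integrable \<pi> (\<lambda>p. (u p)\<^sup>2)"
      using integrable_bounded_dist[OF c(1), of fst snd 1] integrable_bounded_dist[OF c(1), of fst snd 2]
      unfolding u_def by auto
    \<comment> \<open>An arbitrary reference point, from which the Lipschitz bound makes
      \<open>f\<close> bounded.\<close>
    define x0 :: 'a where "x0 = undefined"
    have bf: "norm (f x) \<le> \<bar>f x0\<bar> + L * D" for x
    proof -
      have "L * dist x x0 \<le> L * D" using L D by (intro mult_left_mono) auto
      then show ?thesis using f[of x x0] unfolding real_norm_def by linarith
    qed
    have if1: "integrable \<pi> (\<lambda>p. f (fst p))" "integrable \<pi> (\<lambda>p. f (snd p))"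
      using bf by (auto intro!: P.integrable_const_bound[where B="\<bar>f x0\<bar> + L * D"])
    have "?a = (\<integral>p. f (fst p) - f (snd p) \<partial>\<pi>)"
      using if1 by (simp add: c(4,5)[symmetric] integral_distr)
    then have "\<bar>?a\<bar> \<le> (\<integral>p. \<bar>f (fst p) - f (snd p)\<bar> \<partial>\<pi>)" by simp
    also have "\<dots> \<le> (\<integral>p. L * u p \<partial>\<pi>)"
    proof (rule integral_mono)
      show "\<bar>f (fst p) - f (snd p)\<bar> \<le> L * u p" for p using f by (simp add: u_def)
    qed (use if1 iu in auto)
    also have "\<dots> = L * P.expectation u" by simp
    finally have "\<bar>?a\<bar> / L \<le> P.expectation u" using L by (simp add: divide_simps mult.commute)
    then have "(\<bar>?a\<bar> / L)\<^sup>2 \<le> (P.expectation u)\<^sup>2" using L by (intro power_mono) auto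
    \<comment> \<open>The variance of the distance is nonnegative.\<close>
    also have "\<dots> \<le> P.expectation (\<lambda>p. (u p)\<^sup>2)"
      using P.variance_eq[OF iu] P.variance_positive[of u] by simp
    also have "\<dots> \<le> (wasserstein \<mu> \<nu>)\<^sup>2 + e" using \<pi>(2) by (simp add: transport_cost_def u_def)
    finally show ?thesis by (simp add: power_divide)
  qed
  then have "?a\<^sup>2 / L\<^sup>2 \<le> (wasserstein \<mu> \<nu>)\<^sup>2" by (rule field_le_epsilon)
  then have "?a\<^sup>2 \<le> (L * wasserstein \<mu> \<nu>)\<^sup>2" using L by (simp add: divide_simps power_mult_distrib mult.commute)
  then show ?thesis
    using L wasserstein_nonneg[OF \<mu> \<nu>] abs_le_square_iff[of ?a "L * wasserstein \<mu> \<nu>"] by simp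
qed

section \<open>Kernels obtained from couplings by conditioning on finitely many cells\<close>

text \<open>Given \<open>y\<close>, the kernel draws the first coordinate of \<pi> conditioned on
  the second one lying in the cell of \<open>y\<close>. The \<nu>-mass of a cell is its mass under
  the second marginal of \<pi>, so mixing over \<nu> restores \<mu>. Within a cell \<open>y\<close>
  replaces the true partner, at distance less than \<open>e\<close>, which explains the enlarged
  cost.\<close>

lemma coupling_kernel:
  fixes \<mu> \<nu> :: "'a::compact_metric_space measure"
  assumes \<pi>: "\<pi> \<in> couplings \<mu> \<nu>" and e: "e > 0"
  obtains \<kappa> where "\<kappa> \<in> borel \<rightarrow>\<^sub>M prob_algebra borel" "\<nu> \<bind> \<kappa> = \<mu>"
    "(\<integral>\<^sup>+y. \<integral>\<^sup>+x. ennreal ((dist x y)\<^sup>2) \<partial>\<kappa> y \<partial>\<nu>) \<le> (\<integral>\<^sup>+p. ennreal ((dist (fst p) (snd p) + e)\<^sup>2) \<partial>\<pi>)"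
proof -
  note c = couplingsD[OF \<pi>]
  interpret P: prob_space \<pi> by (rule c(1))
  have [measurable_cong, simp]: "sets \<pi> = sets (borel \<Otimes>\<^sub>M borel)" by (rule c(2))
  have [measurable_cong, simp]: "sets \<mu> = sets borel" "sets \<nu> = sets borel" using c(4,5) by auto
  have fm: "fst \<in> borel_measurable \<pi>" "snd \<in> borel_measurable \<pi>" by measurable
  have ps: "prob_space \<mu>" "prob_space \<nu>"
    using P.prob_space_distr[OF fm(1)] P.prob_space_distr[OF fm(2)] c(4,5) by auto
  have pa: "\<mu> \<in> space (prob_algebra borel)" "\<nu> \<in> space (prob_algebra borel)"
    using ps by (auto simp: space_prob_algebra)
  have [simp]: "space \<mu> = UNIV" "space \<nu> = UNIV"
    by (metis \<open>sets \<mu> = sets borel\<close> \<open>sets \<nu> = sets borel\<close> sets_eq_imp_space_eq space_borel)+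
  obtain F :: "'a set" where F: "finite F" "UNIV \<subseteq> (\<Union>x\<in>F. ball x (e/2))"
    using compact_UNIV_metric[where ?'a = 'a] e unfolding compact_eq_totally_bounded by (metis half_gt_zero)
  obtain xs where xs: "set xs = F" using F(1) finite_list by blast
  define N where "N = length xs"
  have ex: "\<exists>i<N. dist (xs ! i) y < e/2" for y
  proof -
    obtain x where "x \<in> set xs" "dist x y < e/2" using F(2) xs by (auto simp: subset_iff)
    then show ?thesis by (metis N_def in_set_conv_nth)
  qed
  \<comment> \<open>Taking the first centre that is close enough turns the cover by balls into a
    partition; two points of one cell are less than \<open>e\<close> apart.\<close>
  define cell where "cell y = (LEAST i. i < N \<and> dist (xs ! i) y < e/2)" for y
  have cell: "cell y < N" "dist (xs ! cell y) y < e/2" for y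
    using LeastI_ex[of "\<lambda>i. i < N \<and> dist (xs ! i) y < e/2"] ex[of y] by (auto simp: cell_def)
  have cm[measurable]: "cell \<in> measurable borel (count_space UNIV)" unfolding cell_def by measurable
  define A where "A j = {p :: 'a \<times> 'a. cell (snd p) = j}" for j
  have Am[measurable]: "A j \<in> sets (borel \<Otimes>\<^sub>M borel)" for j
  proof -
    have "{p \<in> space (borel \<Otimes>\<^sub>M borel). cell (snd p) = j} \<in> sets (borel \<Otimes>\<^sub>M (borel :: 'a measure))" by measurable
    then show ?thesis by (simp add: A_def space_pair_measure)
  qed
  \<comment> \<open>On cells of mass zero the default \<mu> keeps every \<open>K j\<close> a
    probability measure.\<close>
  define K where "K j = (if emeasure \<pi> (A j) = 0 then \<mu> else distr (uniform_measure \<pi> (A j)) borel fst)" for j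
  have Kp: "K j \<in> space (prob_algebra borel)" for j
  proof (cases "emeasure \<pi> (A j) = 0")
    case True then show ?thesis using pa by (simp add: K_def)
  next
    case False
    then have "prob_space (uniform_measure \<pi> (A j))" by (intro prob_space_uniform_measure) auto
    then have "prob_space (distr (uniform_measure \<pi> (A j)) borel fst)"
      by (rule prob_space.prob_space_distr) (simp cong: measurable_cong_sets)
    then show ?thesis using False by (simp add: K_def space_prob_algebra)
  qed
  define \<kappa> where "\<kappa> y = K (cell y)" for y
  have Km: "K \<in> count_space UNIV \<rightarrow>\<^sub>M prob_algebra borel" using Kp by simp
  have \<kappa>m[measurable]: "\<kappa> \<in> borel \<rightarrow>\<^sub>M prob_algebra borel"
    unfolding \<kappa>_def by (rule measurable_compose[OF cm Km])
  have \<kappa>s: "\<kappa> \<in> borel \<rightarrow>\<^sub>M subprob_algebra borel" by (rule measurable_prob_algebraD[OF \<kappa>m])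
  have \<nu>A: "emeasure \<nu> (cell -` {j}) = emeasure \<pi> (A j)" for j
  proof -
    have "cell -` {j} \<in> sets borel" using measurable_sets[OF cm, of "{j}"] by simp
    then have "emeasure (distr \<pi> borel snd) (cell -` {j}) = emeasure \<pi> (snd -` (cell -` {j}) \<inter> space \<pi>)"
      by (rule emeasure_distr[OF fm(2)])
    also have "snd -` (cell -` {j}) \<inter> space \<pi> = A j" by (auto simp: A_def c(3))
    finally show ?thesis by (simp add: c(5))
  qed
  \<comment> \<open>Used twice: with \<open>g = h\<close> an indicator of the first coordinate for
    the marginal, and with the squared distance against its enlargement by \<open>e\<close> for the
    cost. The proof sums over the cells; on each of them the normalisation of the conditional law
    cancels against the \<nu>-mass of the cell.\<close>
  have main: "(\<integral>\<^sup>+y. \<integral>\<^sup>+x. g (x, y) \<partial>\<kappa> y \<partial>\<nu>) \<le> (\<integral>\<^sup>+p. h p \<partial>\<pi>)"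
    if gm[measurable]: "g \<in> borel_measurable (borel \<Otimes>\<^sub>M borel)" and hm[measurable]: "h \<in> borel_measurable (borel \<Otimes>\<^sub>M borel)"
      and gh: "\<And>x y y'. cell y = cell y' \<Longrightarrow> g (x, y) \<le> h (x, y')" for g h :: "'a \<times> 'a \<Rightarrow> ennreal"
  proof -
    define G where "G y = (\<integral>\<^sup>+x. g (x, y) \<partial>\<kappa> y)" for y
    have Gm[measurable]: "G \<in> borel_measurable borel"
      unfolding G_def by (rule nn_integral_measurable_subprob_algebra2[OF _ \<kappa>s]) measurable
    have cs[measurable]: "cell -` {j} \<in> sets borel" for j using measurable_sets[OF cm, of "{j}"] by simp
    have "(\<integral>\<^sup>+y. G y \<partial>\<nu>) = (\<integral>\<^sup>+y. (\<Sum>j<N. G y * indicator (cell -` {j}) y) \<partial>\<nu>)"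
    proof (rule nn_integral_cong)
      fix y
      have "(\<Sum>j<N. G y * indicator (cell -` {j}) y) = (\<Sum>j<N. if j = cell y then G y else 0)"
        by (rule sum.cong) (auto simp: indicator_def)
      then show "G y = (\<Sum>j<N. G y * indicator (cell -` {j}) y)" using cell(1)[of y] by simp
    qed
    also have "\<dots> = (\<Sum>j<N. \<integral>\<^sup>+y. G y * indicator (cell -` {j}) y \<partial>\<nu>)"
      by (rule nn_integral_sum) measurable
    also have "\<dots> \<le> (\<Sum>j<N. \<integral>\<^sup>+p. h p * indicator (A j) p \<partial>\<pi>)"
    proof (rule sum_mono)
      fix j
      let ?H = "\<integral>\<^sup>+p. h p * indicator (A j) p \<partial>\<pi>"
      show "(\<integral>\<^sup>+y. G y * indicator (cell -` {j}) y \<partial>\<nu>) \<le> ?H"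
      proof (cases "emeasure \<pi> (A j) = 0")
        case True
        then have "cell -` {j} \<in> null_sets \<nu>" using \<nu>A[of j] by (auto simp: null_sets_def)
        then show ?thesis by (simp add: nn_integral_null_set)
      next
        case False
        have fin: "emeasure \<pi> (A j) \<noteq> \<infinity>" by simp
        have le: "G y \<le> ?H / emeasure \<pi> (A j)" if y: "cell y = j" for y
        proof -
          have "G y = (\<integral>\<^sup>+x. g (x, y) \<partial>distr (uniform_measure \<pi> (A j)) borel fst)"
            using False y by (simp add: G_def \<kappa>_def K_def)
          also have "\<dots> = (\<integral>\<^sup>+p. g (fst p, y) \<partial>uniform_measure \<pi> (A j))"
            by (rule nn_integral_distr) (auto cong: measurable_cong_sets)
          also have "\<dots> = (\<integral>\<^sup>+p. g (fst p, y) * indicator (A j) p \<partial>\<pi>) / emeasure \<pi> (A j)"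
            by (rule nn_integral_uniform_measure) auto
          also have "\<dots> \<le> ?H / emeasure \<pi> (A j)"
          proof (intro divide_right_mono_ennreal nn_integral_mono)
            fix p :: "'a \<times> 'a"
            show "g (fst p, y) * indicator (A j) p \<le> h p * indicator (A j) p"
              using gh[of y "snd p" "fst p"] y by (auto simp: indicator_def A_def)
          qed
          finally show ?thesis .
        qed
        have "(\<integral>\<^sup>+y. G y * indicator (cell -` {j}) y \<partial>\<nu>)
            \<le> (\<integral>\<^sup>+y. ?H / emeasure \<pi> (A j) * indicator (cell -` {j}) y \<partial>\<nu>)"
          by (rule nn_integral_mono) (use le in \<open>auto simp: indicator_def\<close>)
        also have "\<dots> = ?H / emeasure \<pi> (A j) * emeasure \<pi> (A j)"
          by (simp add: nn_integral_cmult_indicator \<nu>A)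
        also have "\<dots> = ?H"
          using False fin ennreal_divide_self[of "emeasure \<pi> (A j)"]
          by (simp add: ennreal_divide_times less_top[symmetric])
        finally show ?thesis .
      qed
    qed
    also have "\<dots> = (\<integral>\<^sup>+p. (\<Sum>j<N. h p * indicator (A j) p) \<partial>\<pi>)"
      by (rule nn_integral_sum[symmetric]) measurable
    also have "\<dots> = (\<integral>\<^sup>+p. h p \<partial>\<pi>)"
    proof (rule nn_integral_cong)
      fix p :: "'a \<times> 'a"
      have "(\<Sum>j<N. h p * indicator (A j) p) = (\<Sum>j<N. if j = cell (snd p) then h p else 0)"
        by (rule sum.cong) (auto simp: indicator_def A_def)
      then show "(\<Sum>j<N. h p * indicator (A j) p) = h p" using cell(1)[of "snd p"] by simp
    qed
    finally show ?thesis by (simp add: G_def)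
  qed
  have sb: "sets (\<nu> \<bind> \<kappa>) = sets borel" by (rule sets_bind'[OF pa(2) \<kappa>m])
  have pb: "prob_space (\<nu> \<bind> \<kappa>)" by (rule prob_space_bind'[OF pa(2) \<kappa>m])
  interpret B: prob_space "\<nu> \<bind> \<kappa>" by (rule pb)
  interpret M: prob_space \<mu> by (rule ps(1))
  have le: "emeasure (\<nu> \<bind> \<kappa>) X \<le> emeasure \<mu> X" if X[measurable]: "X \<in> sets borel" for X
  proof -
    have "emeasure (\<nu> \<bind> \<kappa>) X = (\<integral>\<^sup>+y. emeasure (\<kappa> y) X \<partial>\<nu>)"
      by (rule emeasure_bind_prob_algebra[OF pa(2) \<kappa>m X])
    also have "\<dots> = (\<integral>\<^sup>+y. \<integral>\<^sup>+x. indicator X x \<partial>\<kappa> y \<partial>\<nu>)"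
      using Kp X by (intro nn_integral_cong nn_integral_indicator[symmetric])
        (auto simp: \<kappa>_def space_prob_algebra)
    also have "\<dots> \<le> (\<integral>\<^sup>+p. indicator X (fst p) \<partial>\<pi>)"
      using main[of "\<lambda>p. indicator X (fst p)" "\<lambda>p. indicator X (fst p)"] by simp
    also have "\<dots> = emeasure \<mu> X"
      by (simp add: c(4)[symmetric] nn_integral_distr[symmetric, of fst \<pi> borel] )
    finally show ?thesis .
  qed
  \<comment> \<open>One inequality on all sets is enough: both are probability measures, so passing
    to complements reverses it.\<close>
  have "\<nu> \<bind> \<kappa> = \<mu>"
  proof (rule measure_eqI)
    show "sets (\<nu> \<bind> \<kappa>) = sets \<mu>" using sb by simp
    fix X assume "X \<in> sets (\<nu> \<bind> \<kappa>)"
    then have X: "X \<in> sets borel" using sb by simp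
    have "emeasure (\<nu> \<bind> \<kappa>) (UNIV - X) \<le> emeasure \<mu> (UNIV - X)" using X by (intro le) auto
    moreover have "measure (\<nu> \<bind> \<kappa>) (UNIV - X) = 1 - measure (\<nu> \<bind> \<kappa>) X"
      using B.prob_compl[of X] X sb sets_eq_imp_space_eq[OF sb] by simp
    moreover have "measure \<mu> (UNIV - X) = 1 - measure \<mu> X" using M.prob_compl[of X] X by simp
    ultimately have "measure \<mu> X \<le> measure (\<nu> \<bind> \<kappa>) X"
      by (simp add: B.emeasure_eq_measure M.emeasure_eq_measure)
    then show "emeasure (\<nu> \<bind> \<kappa>) X = emeasure \<mu> X"
      using le[OF X] by (simp add: B.emeasure_eq_measure M.emeasure_eq_measure)
  qed
  moreover have "(\<integral>\<^sup>+y. \<integral>\<^sup>+x. ennreal ((dist x y)\<^sup>2) \<partial>\<kappa> y \<partial>\<nu>) \<le> (\<integral>\<^sup>+p. ennreal ((dist (fst p) (snd p) + e)\<^sup>2) \<partial>\<pi>)"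
  proof -
    have "(dist x y)\<^sup>2 \<le> (dist x y' + e)\<^sup>2" if "cell y = cell y'" for x y y' :: 'a
    proof -
      have "dist y y' < e"
        using cell(2)[of y] cell(2)[of y'] that dist_triangle_half_r[of "xs ! cell y" y e y'] by simp
      then have "dist x y \<le> dist x y' + e" using dist_triangle[of x y y'] by (simp add: dist_commute)
      then show ?thesis by (intro power_mono) auto
    qed
    then show ?thesis
      using main[of "\<lambda>p. ennreal ((dist (fst p) (snd p))\<^sup>2)" "\<lambda>p. ennreal ((dist (fst p) (snd p) + e)\<^sup>2)"]
      by (simp add: ennreal_leI)
  qed
  ultimately show ?thesis using that \<kappa>m by blast
qed

lemma near_optimal_kernel:
  fixes \<mu> \<nu> :: "'a::compact_metric_space measure"
  assumes \<mu>: "\<mu> \<in> space (prob_algebra borel)" and \<nu>: "\<nu> \<in> space (prob_algebra borel)" and e: "e > 0"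
  obtains \<kappa> where "\<kappa> \<in> borel \<rightarrow>\<^sub>M prob_algebra borel" "\<nu> \<bind> \<kappa> = \<mu>"
    "(\<integral>\<^sup>+y. \<integral>\<^sup>+x. ennreal ((dist x y)\<^sup>2) \<partial>\<kappa> y \<partial>\<nu>) \<le> ennreal ((wasserstein \<mu> \<nu>)\<^sup>2 + e)"
proof -
  obtain D where D: "D > 0" "\<And>x y :: 'a. dist x y \<le> D" using compact_metric_bounded[where 'a='a] by blast
  have e2: "e/2 > 0" using e by simp
  obtain \<pi> where \<pi>: "\<pi> \<in> couplings \<mu> \<nu>" "transport_cost \<pi> < (wasserstein \<mu> \<nu>)\<^sup>2 + e/2"
    using near_optimal_coupling[OF \<mu> \<nu> e2] .
  interpret P: prob_space \<pi> by (rule couplingsD(1)[OF \<pi>(1)])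
  have [measurable_cong]: "sets \<pi> = sets (borel \<Otimes>\<^sub>M borel)" by (rule couplingsD(2)[OF \<pi>(1)])
  \<comment> \<open>Enlarging a distance r <= D by d <= 1 raises its square by d (2 r + d), at most
    d (2 D + 1). One half of \<open>e\<close> pays for this, the other for the coupling.\<close>
  define d where "d = min 1 (e / (2 * (2 * D + 1)))"
  have d: "d > 0" "d \<le> 1" "d * (2 * D + 1) \<le> e/2"
  proof -
    show "d > 0" "d \<le> 1" using e D by (auto simp: d_def)
    have "d \<le> e / (2 * (2 * D + 1))" by (simp add: d_def)
    then show "d * (2 * D + 1) \<le> e/2" using D by (simp add: field_simps)
  qed
  obtain \<kappa> where \<kappa>: "\<kappa> \<in> borel \<rightarrow>\<^sub>M prob_algebra borel" "\<nu> \<bind> \<kappa> = \<mu>"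
    "(\<integral>\<^sup>+y. \<integral>\<^sup>+x. ennreal ((dist x y)\<^sup>2) \<partial>\<kappa> y \<partial>\<nu>) \<le> (\<integral>\<^sup>+p. ennreal ((dist (fst p) (snd p) + d)\<^sup>2) \<partial>\<pi>)"
    using coupling_kernel[OF \<pi>(1) d(1)] .
  have int: "integrable \<pi> (\<lambda>p. (dist (fst p) (snd p))\<^sup>2)"
    by (rule integrable_bounded_dist[OF P.prob_space_axioms]) measurable
  have pt: "(dist x y + d)\<^sup>2 \<le> (dist x y)\<^sup>2 + e/2" for x y :: 'a
  proof -
    have "(dist x y + d)\<^sup>2 = (dist x y)\<^sup>2 + d * (2 * dist x y + d)" by (simp add: power2_eq_square algebra_simps)
    also have "d * (2 * dist x y + d) \<le> d * (2 * D + 1)" using d D by (intro mult_left_mono add_mono) auto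
    finally show ?thesis using d(3) by simp
  qed
  have "(\<integral>\<^sup>+p. ennreal ((dist (fst p) (snd p) + d)\<^sup>2) \<partial>\<pi>) \<le> (\<integral>\<^sup>+p. ennreal ((dist (fst p) (snd p))\<^sup>2 + e/2) \<partial>\<pi>)"
    by (intro nn_integral_mono ennreal_leI pt)
  also have "\<dots> = ennreal (\<integral>p. (dist (fst p) (snd p))\<^sup>2 + e/2 \<partial>\<pi>)"
    using int e by (intro nn_integral_eq_integral) auto
  also have "(\<integral>p. (dist (fst p) (snd p))\<^sup>2 + e/2 \<partial>\<pi>) = transport_cost \<pi> + e/2"
    using int by (simp add: transport_cost_def P.prob_space)
  also have "ennreal \<dots> \<le> ennreal ((wasserstein \<mu> \<nu>)\<^sup>2 + e)" using \<pi>(2) by (intro ennreal_leI) simp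
  finally show ?thesis using that \<kappa> order_trans by blast
qed

section \<open>Metric axioms for the Wasserstein distance\<close>

lemma wasserstein_commute_le:
  fixes \<mu> \<nu> :: "'a::compact_metric_space measure"
  assumes \<mu>: "\<mu> \<in> space (prob_algebra borel)" and \<nu>: "\<nu> \<in> space (prob_algebra borel)"
  shows "wasserstein \<nu> \<mu> \<le> wasserstein \<mu> \<nu>"
proof -
  have "(wasserstein \<nu> \<mu>)\<^sup>2 \<le> (wasserstein \<mu> \<nu>)\<^sup>2 + e" if e: "e > 0" for e
  proof -
    obtain \<pi> where \<pi>: "\<pi> \<in> couplings \<mu> \<nu>" "transport_cost \<pi> < (wasserstein \<mu> \<nu>)\<^sup>2 + e"
      using near_optimal_coupling[OF \<mu> \<nu> e] .
    note c = couplingsD[OF \<pi>(1)]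
    have [measurable_cong]: "sets \<pi> = sets (borel \<Otimes>\<^sub>M borel)" by (rule c(2))
    have "wasserstein (distr \<pi> borel snd) (distr \<pi> borel fst) \<le> L2_dist \<pi> snd fst"
      by (rule wasserstein_le_L2_dist[OF c(1)]) measurable
    also have "\<dots> = sqrt (transport_cost \<pi>)" by (simp add: L2_dist_def transport_cost_def dist_commute)
    finally have "wasserstein \<nu> \<mu> \<le> sqrt (transport_cost \<pi>)" by (simp add: c(4,5))
    then have "(wasserstein \<nu> \<mu>)\<^sup>2 \<le> (sqrt (transport_cost \<pi>))\<^sup>2"
      using wasserstein_nonneg[OF \<nu> \<mu>] by (intro power_mono)
    then show ?thesis using \<pi>(2) by (simp add: transport_cost_def)
  qed
  then have "(wasserstein \<nu> \<mu>)\<^sup>2 \<le> (wasserstein \<mu> \<nu>)\<^sup>2" by (rule field_le_epsilon)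
  then show ?thesis using wasserstein_nonneg[OF \<mu> \<nu>] by (rule power2_le_imp_le)
qed

lemma nn_integral_pair_fst_snd:
  fixes f :: "'a \<Rightarrow> ennreal" and g :: "'b \<Rightarrow> ennreal"
  assumes "prob_space M" "prob_space N" and [measurable]: "f \<in> borel_measurable M" "g \<in> borel_measurable N"
  shows "(\<integral>\<^sup>+p. f (fst p) + g (snd p) \<partial>(M \<Otimes>\<^sub>M N)) = (\<integral>\<^sup>+x. f x \<partial>M) + (\<integral>\<^sup>+y. g y \<partial>N)"
proof -
  interpret M: prob_space M by fact
  interpret N: prob_space N by fact
  have "(\<integral>\<^sup>+p. f (fst p) + g (snd p) \<partial>(M \<Otimes>\<^sub>M N)) = (\<integral>\<^sup>+x. \<integral>\<^sup>+y. f x + g y \<partial>N \<partial>M)"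
    by (subst N.nn_integral_fst[symmetric]) auto
  also have "\<dots> = (\<integral>\<^sup>+x. f x + (\<integral>\<^sup>+y. g y \<partial>N) \<partial>M)"
    by (intro nn_integral_cong) (simp add: nn_integral_add N.emeasure_space_1)
  also have "\<dots> = (\<integral>\<^sup>+x. f x \<partial>M) + (\<integral>\<^sup>+y. g y \<partial>N)"
    by (simp add: nn_integral_add M.emeasure_space_1)
  finally show ?thesis .
qed

text \<open>The gap between the two sides is a square divided by \<open>l\<close>. The free weight
  serves the triangle inequality: for l = b / a both sides agree.\<close>

lemma sum_square_weighted_le:
  fixes a b l :: real
  assumes "l > 0"
  shows "(a + b)\<^sup>2 \<le> (1 + l) * a\<^sup>2 + (1 + 1 / l) * b\<^sup>2"
proof -
  have "(1 + l) * a\<^sup>2 + (1 + 1 / l) * b\<^sup>2 - (a + b)\<^sup>2 = (l * a - b)\<^sup>2 / l"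
    using assms by (simp add: field_simps power2_eq_square)
  moreover have "\<dots> \<ge> 0" using assms by simp
  ultimately show ?thesis by linarith
qed

text \<open>Gluing at the middle measure: given a \<nu>-distributed point, the two endpoints are
  drawn independently from kernels towards \<mu> and \<rho>, and their joint law couples \<mu> and
  \<rho>. The weighted bound on the squared distance is pointwise and linear in the two costs, so it
  can be integrated without Minkowski's inequality.\<close>

lemma wasserstein_weighted_triangle:
  fixes \<mu> \<nu> \<rho> :: "'a::compact_metric_space measure"
  assumes \<mu>: "\<mu> \<in> space (prob_algebra borel)" and \<nu>: "\<nu> \<in> space (prob_algebra borel)"
    and \<rho>: "\<rho> \<in> space (prob_algebra borel)" and l: "l > 0" and e: "e > 0"
  shows "(wasserstein \<mu> \<rho>)\<^sup>2 \<le> (1 + l) * ((wasserstein \<mu> \<nu>)\<^sup>2 + e) + (1 + 1 / l) * ((wasserstein \<rho> \<nu>)\<^sup>2 + e)"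
proof -
  obtain \<kappa> where \<kappa>[measurable]: "\<kappa> \<in> borel \<rightarrow>\<^sub>M prob_algebra borel" and \<kappa>b: "\<nu> \<bind> \<kappa> = \<mu>"
    and \<kappa>c: "(\<integral>\<^sup>+y. \<integral>\<^sup>+x. ennreal ((dist x y)\<^sup>2) \<partial>\<kappa> y \<partial>\<nu>) \<le> ennreal ((wasserstein \<mu> \<nu>)\<^sup>2 + e)"
    using near_optimal_kernel[OF \<mu> \<nu> e] .
  obtain \<eta> where \<eta>[measurable]: "\<eta> \<in> borel \<rightarrow>\<^sub>M prob_algebra borel" and \<eta>b: "\<nu> \<bind> \<eta> = \<rho>"
    and \<eta>c: "(\<integral>\<^sup>+y. \<integral>\<^sup>+x. ennreal ((dist x y)\<^sup>2) \<partial>\<eta> y \<partial>\<nu>) \<le> ennreal ((wasserstein \<rho> \<nu>)\<^sup>2 + e)"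
    using near_optimal_kernel[OF \<rho> \<nu> e] .
  have [measurable_cong, simp]: "sets \<nu> = sets borel" using \<nu> by (simp add: space_prob_algebra)
  have ps: "prob_space (\<kappa> y)" "prob_space (\<eta> y)" and st[measurable_cong, simp]: "sets (\<kappa> y) = sets borel" "sets (\<eta> y) = sets borel" for y
    using measurable_space[OF \<kappa>, of y] measurable_space[OF \<eta>, of y] by (auto simp: space_prob_algebra)
  define J where "J y = \<kappa> y \<Otimes>\<^sub>M \<eta> y" for y
  have J[measurable]: "J \<in> borel \<rightarrow>\<^sub>M prob_algebra (borel \<Otimes>\<^sub>M borel)" unfolding J_def by measurable
  have J': "J \<in> \<nu> \<rightarrow>\<^sub>M subprob_algebra (borel \<Otimes>\<^sub>M borel)"
    using measurable_prob_algebraD[OF J] by (simp cong: measurable_cong_sets)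
  define Q where "Q = \<nu> \<bind> J"
  have Q: "prob_space Q" and [measurable_cong, simp]: "sets Q = sets (borel \<Otimes>\<^sub>M borel)"
    unfolding Q_def using prob_space_bind'[OF \<nu> J] sets_bind'[OF \<nu> J] by auto
  have nQ: "(\<integral>\<^sup>+p. h p \<partial>Q) = (\<integral>\<^sup>+y. \<integral>\<^sup>+p. h p \<partial>J y \<partial>\<nu>)" if "h \<in> borel_measurable (borel \<Otimes>\<^sub>M borel)" for h
    unfolding Q_def by (rule nn_integral_bind[OF that J'])
  have nk: "(\<integral>\<^sup>+p. f (fst p) + g (snd p) \<partial>J y) = (\<integral>\<^sup>+x. f x \<partial>\<kappa> y) + (\<integral>\<^sup>+y. g y \<partial>\<eta> y)"
    if "f \<in> borel_measurable borel" "g \<in> borel_measurable borel" for f g y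
    unfolding J_def using that by (intro nn_integral_pair_fst_snd ps) (auto cong: measurable_cong_sets)
  have "distr Q borel fst = \<mu>"
  proof (rule measure_eqI)
    show "sets (distr Q borel fst) = sets \<mu>" using \<mu> by (simp add: space_prob_algebra)
    fix X assume "X \<in> sets (distr Q borel fst)"
    then have X[measurable]: "X \<in> sets borel" by simp
    have "emeasure (distr Q borel fst) X = (\<integral>\<^sup>+x. indicator X x \<partial>distr Q borel fst)" by simp
    also have "\<dots> = (\<integral>\<^sup>+p. indicator X (fst p) \<partial>Q)" by (rule nn_integral_distr) measurable
    also have "\<dots> = (\<integral>\<^sup>+y. emeasure (\<kappa> y) X \<partial>\<nu>)"
      using nk[of "indicator X" "\<lambda>_. 0"] by (subst nQ) auto
    also have "\<dots> = emeasure \<mu> X" using emeasure_bind_prob_algebra[OF \<nu> \<kappa> X] \<kappa>b by simp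
    finally show "emeasure (distr Q borel fst) X = emeasure \<mu> X" .
  qed
  moreover have "distr Q borel snd = \<rho>"
  proof (rule measure_eqI)
    show "sets (distr Q borel snd) = sets \<rho>" using \<rho> by (simp add: space_prob_algebra)
    fix X assume "X \<in> sets (distr Q borel snd)"
    then have X[measurable]: "X \<in> sets borel" by simp
    have "emeasure (distr Q borel snd) X = (\<integral>\<^sup>+x. indicator X x \<partial>distr Q borel snd)" by simp
    also have "\<dots> = (\<integral>\<^sup>+p. indicator X (snd p) \<partial>Q)" by (rule nn_integral_distr) measurable
    also have "\<dots> = (\<integral>\<^sup>+y. emeasure (\<eta> y) X \<partial>\<nu>)"
      using nk[of "\<lambda>_. 0" "indicator X"] by (subst nQ) auto
    also have "\<dots> = emeasure \<rho> X" using emeasure_bind_prob_algebra[OF \<nu> \<eta> X] \<eta>b by simp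
    finally show "emeasure (distr Q borel snd) X = emeasure \<rho> X" .
  qed
  ultimately have QC: "Q \<in> couplings \<mu> \<rho>" using Q by (auto simp: couplings_def space_prob_algebra)
  have int: "integrable Q (\<lambda>p. (dist (fst p) (snd p))\<^sup>2)"
    by (rule integrable_bounded_dist[OF Q]) measurable
  have "ennreal (transport_cost Q) = (\<integral>\<^sup>+p. ennreal ((dist (fst p) (snd p))\<^sup>2) \<partial>Q)"
    unfolding transport_cost_def using int by (intro nn_integral_eq_integral[symmetric]) auto
  also have "\<dots> = (\<integral>\<^sup>+y. \<integral>\<^sup>+p. ennreal ((dist (fst p) (snd p))\<^sup>2) \<partial>J y \<partial>\<nu>)" by (rule nQ) measurable
  also have "\<dots> \<le> (\<integral>\<^sup>+y. \<integral>\<^sup>+p. ennreal ((1 + l) * (dist (fst p) y)\<^sup>2) + ennreal ((1 + 1 / l) * (dist (snd p) y)\<^sup>2) \<partial>J y \<partial>\<nu>)"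
  proof (intro nn_integral_mono)
    fix y and p :: "'a \<times> 'a"
    have "(dist (fst p) (snd p))\<^sup>2 \<le> (dist (fst p) y + dist (snd p) y)\<^sup>2"
      by (intro power_mono dist_triangle2) auto
    also have "\<dots> \<le> (1 + l) * (dist (fst p) y)\<^sup>2 + (1 + 1 / l) * (dist (snd p) y)\<^sup>2"
      by (rule sum_square_weighted_le[OF l])
    finally show "ennreal ((dist (fst p) (snd p))\<^sup>2) \<le> ennreal ((1 + l) * (dist (fst p) y)\<^sup>2) + ennreal ((1 + 1 / l) * (dist (snd p) y)\<^sup>2)"
      using l by (simp add: ennreal_plus[symmetric] ennreal_leI del: ennreal_plus)
  qed
  also have "\<dots> = (\<integral>\<^sup>+y. (\<integral>\<^sup>+x. ennreal ((1 + l) * (dist x y)\<^sup>2) \<partial>\<kappa> y) + (\<integral>\<^sup>+x. ennreal ((1 + 1 / l) * (dist x y)\<^sup>2) \<partial>\<eta> y) \<partial>\<nu>)"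
    by (intro nn_integral_cong nk) measurable
  also have "\<dots> = (\<integral>\<^sup>+y. ennreal (1 + l) * (\<integral>\<^sup>+x. ennreal ((dist x y)\<^sup>2) \<partial>\<kappa> y) + ennreal (1 + 1 / l) * (\<integral>\<^sup>+x. ennreal ((dist x y)\<^sup>2) \<partial>\<eta> y) \<partial>\<nu>)"
    using l by (intro nn_integral_cong) (simp add: ennreal_mult nn_integral_cmult)
  also have "\<dots> = ennreal (1 + l) * (\<integral>\<^sup>+y. \<integral>\<^sup>+x. ennreal ((dist x y)\<^sup>2) \<partial>\<kappa> y \<partial>\<nu>) + ennreal (1 + 1 / l) * (\<integral>\<^sup>+y. \<integral>\<^sup>+x. ennreal ((dist x y)\<^sup>2) \<partial>\<eta> y \<partial>\<nu>)"
  proof -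
    have "(\<lambda>y. \<integral>\<^sup>+x. ennreal ((dist x y)\<^sup>2) \<partial>\<kappa> y) \<in> borel_measurable borel"
      by (rule nn_integral_measurable_subprob_algebra2[OF _ measurable_prob_algebraD[OF \<kappa>]]) measurable
    moreover have "(\<lambda>y. \<integral>\<^sup>+x. ennreal ((dist x y)\<^sup>2) \<partial>\<eta> y) \<in> borel_measurable borel"
      by (rule nn_integral_measurable_subprob_algebra2[OF _ measurable_prob_algebraD[OF \<eta>]]) measurable
    ultimately show ?thesis by (subst nn_integral_add) (auto simp: nn_integral_cmult)
  qed
  also have "\<dots> \<le> ennreal (1 + l) * ennreal ((wasserstein \<mu> \<nu>)\<^sup>2 + e) + ennreal (1 + 1 / l) * ennreal ((wasserstein \<rho> \<nu>)\<^sup>2 + e)"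
    using \<kappa>c \<eta>c by (intro add_mono mult_left_mono) auto
  also have "\<dots> = ennreal ((1 + l) * ((wasserstein \<mu> \<nu>)\<^sup>2 + e) + (1 + 1 / l) * ((wasserstein \<rho> \<nu>)\<^sup>2 + e))"
    using l e by (simp add: ennreal_mult ennreal_plus)
  finally have "transport_cost Q \<le> (1 + l) * ((wasserstein \<mu> \<nu>)\<^sup>2 + e) + (1 + 1 / l) * ((wasserstein \<rho> \<nu>)\<^sup>2 + e)"
    using l e by (subst (asm) ennreal_le_iff) (auto intro!: add_nonneg_nonneg mult_nonneg_nonneg)
  then show ?thesis using wasserstein_sq_le_cost[OF QC] by linarith
qed

text \<open>The marginals of a joint probability law are probability laws. So as soon as one
  argument is no probability measure, \<open>wasserstein\<close> equals the constant
  \<open>sqrt (Inf {})\<close>.\<close>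

lemma couplings_empty:
  assumes "\<not> (\<mu> \<in> space (prob_algebra borel) \<and> \<nu> \<in> space (prob_algebra borel))"
  shows "couplings \<mu> \<nu> = {}" "couplings \<nu> \<mu> = {}"
proof -
  have "\<mu> \<in> space (prob_algebra borel) \<and> \<nu> \<in> space (prob_algebra borel)" if "\<pi> \<in> couplings \<mu> \<nu>" for \<pi> and \<mu> \<nu> :: "'a::topological_space measure"
  proof -
    have "sets \<pi> = sets (borel \<Otimes>\<^sub>M borel)" "prob_space \<pi>" and eq: "distr \<pi> borel fst = \<mu>" "distr \<pi> borel snd = \<nu>"
      using that by (auto simp: couplings_def space_prob_algebra)
    then have "prob_space (distr \<pi> borel fst)" "prob_space (distr \<pi> borel snd)"
      by (auto intro!: prob_space.prob_space_distr cong: measurable_cong_sets)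
    then show ?thesis using eq by (auto simp: space_prob_algebra)
  qed
  then show "couplings \<mu> \<nu> = {}" "couplings \<nu> \<mu> = {}" using assms by blast+
qed

lemma wasserstein_commute:
  fixes \<mu> \<nu> :: "'a::compact_metric_space measure"
  shows "wasserstein \<mu> \<nu> = wasserstein \<nu> \<mu>"
proof (cases "\<mu> \<in> space (prob_algebra borel) \<and> \<nu> \<in> space (prob_algebra borel)")
  case True
  then show ?thesis using wasserstein_commute_le by (metis order_antisym)
next
  case False
  then show ?thesis by (simp add: wasserstein_def couplings_empty[OF False])
qed

lemma wasserstein_triangle:
  fixes \<mu> \<nu> \<rho> :: "'a::compact_metric_space measure"
  assumes \<mu>: "\<mu> \<in> space (prob_algebra borel)" and \<nu>: "\<nu> \<in> space (prob_algebra borel)"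
    and \<rho>: "\<rho> \<in> space (prob_algebra borel)"
  shows "wasserstein \<mu> \<rho> \<le> wasserstein \<mu> \<nu> + wasserstein \<nu> \<rho>"
proof (rule field_le_epsilon)
  fix d :: real assume d: "d > 0"
  \<comment> \<open>The added d/2 makes both numbers positive, so that the weight b / a is defined,
    and it absorbs the error d^2/4 of the kernels: (W + d/2)^2 >= W^2 + d^2/4.\<close>
  define a where "a = wasserstein \<mu> \<nu> + d/2"
  define b where "b = wasserstein \<nu> \<rho> + d/2"
  have ab: "a > 0" "b > 0"
    using d wasserstein_nonneg[OF \<mu> \<nu>] wasserstein_nonneg[OF \<nu> \<rho>] by (auto simp: a_def b_def)
  have W: "(wasserstein \<mu> \<nu>)\<^sup>2 + d\<^sup>2/4 \<le> a\<^sup>2" "(wasserstein \<rho> \<nu>)\<^sup>2 + d\<^sup>2/4 \<le> b\<^sup>2"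
    using d wasserstein_nonneg[OF \<mu> \<nu>] wasserstein_nonneg[OF \<nu> \<rho>]
    by (auto simp: a_def b_def wasserstein_commute[of \<rho>] power2_eq_square algebra_simps)
  have "(wasserstein \<mu> \<rho>)\<^sup>2 \<le> (1 + b / a) * ((wasserstein \<mu> \<nu>)\<^sup>2 + d\<^sup>2/4) + (1 + 1 / (b / a)) * ((wasserstein \<rho> \<nu>)\<^sup>2 + d\<^sup>2/4)"
    using ab d by (intro wasserstein_weighted_triangle assms) auto
  also have "\<dots> \<le> (1 + b / a) * a\<^sup>2 + (1 + 1 / (b / a)) * b\<^sup>2"
    using ab W by (intro add_mono mult_left_mono) auto
  also have "\<dots> = (a + b)\<^sup>2" using ab by (simp add: field_simps power2_eq_square)
  finally have "wasserstein \<mu> \<rho> \<le> a + b" using ab by (metis power2_le_imp_le add_nonneg_nonneg less_imp_le)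
  then show "wasserstein \<mu> \<rho> \<le> wasserstein \<mu> \<nu> + wasserstein \<nu> \<rho> + d" by (simp add: a_def b_def)
qed

lemma wasserstein_self:
  fixes \<mu> :: "'a::compact_metric_space measure"
  assumes \<mu>: "\<mu> \<in> space (prob_algebra borel)"
  shows "wasserstein \<mu> \<mu> = 0"
proof -
  have p: "prob_space \<mu>" and s: "sets \<mu> = sets borel" using \<mu> by (auto simp: space_prob_algebra)
  have "wasserstein (distr \<mu> borel (\<lambda>x. x)) (distr \<mu> borel (\<lambda>x. x)) \<le> L2_dist \<mu> (\<lambda>x. x) (\<lambda>x. x)"
    by (rule wasserstein_le_L2_dist[OF p]) (use s in \<open>auto cong: measurable_cong_sets\<close>)
  moreover have "distr \<mu> borel (\<lambda>x. x) = \<mu>" using s by (rule distr_id2[OF sym])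
  ultimately show ?thesis
    using wasserstein_nonneg[OF \<mu> \<mu>] by (simp add: L2_dist_def)
qed

text \<open>Off the probability measures the Wasserstein distance is the square root of the unspecified
  infimum of the empty set, while \<^const>\<open>Metric_space\<close> demands nonnegativity everywhere.\<close>

lemma Metric_space_wasserstein:
  assumes "0 \<le> (Inf {} :: real)"
  shows "Metric_space (space (prob_algebra borel)) (wasserstein :: 'a::compact_metric_space measure \<Rightarrow> _)"
proof
  fix \<mu> \<nu> \<rho> :: "'a measure"
  show "0 \<le> wasserstein \<mu> \<nu>"
  proof (cases "\<mu> \<in> space (prob_algebra borel) \<and> \<nu> \<in> space (prob_algebra borel)")
    case True
    then show ?thesis using wasserstein_nonneg by blast
  next
    case False
    then show ?thesis using assms by (simp add: wasserstein_def couplings_empty[OF False])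
  qed
  show "wasserstein \<mu> \<nu> = wasserstein \<nu> \<mu>" by (rule wasserstein_commute)
  assume \<mu>: "\<mu> \<in> space (prob_algebra borel)" and \<nu>: "\<nu> \<in> space (prob_algebra borel)"
  show "wasserstein \<mu> \<nu> = 0 \<longleftrightarrow> \<mu> = \<nu>"
  proof
    assume W: "wasserstein \<mu> \<nu> = 0"
    show "\<mu> = \<nu>"
      by (rule measure_eqI_lipschitz[OF \<mu> \<nu>])
        (use lipschitz_integral_diff_le_wasserstein[OF \<mu> \<nu>] W in force)
  next
    assume "\<mu> = \<nu>"
    then show "wasserstein \<mu> \<nu> = 0" using wasserstein_self[OF \<mu>] by simp
  qed
  assume "\<rho> \<in> space (prob_algebra borel)"
  then show "wasserstein \<mu> \<rho> \<le> wasserstein \<mu> \<nu> + wasserstein \<nu> \<rho>"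
    using wasserstein_triangle \<mu> \<nu> by blast
qed

subsection \<open>Energy\<close>

lemma unit_partition_range:
  assumes up: "unit_partition n t" and "i \<le> n"
  shows "t i \<in> {0..1}"
proof -
  have "t i \<le> t j" if "i \<le> j" "j \<le> n" for i j
    using that
  proof (induction j rule: dec_induct)
    case (step m)
    then have "Suc m \<in> {1..n}" by simp
    then have "t (Suc m - 1) < t (Suc m)" using up unfolding unit_partition_def by blast
    then show ?case using step by simp
  qed simp
  from this[of 0 i] this[of i n] show ?thesis using assms by (simp add: unit_partition_def)
qed

lemma energy_sum_le:
  assumes E: "energy D f < \<infinity>" and p: "unit_partition n p"
  shows "(\<Sum>i=1..n. (D (f (p i)) (f (p (i - 1))))\<^sup>2 / (p i - p (i - 1))) \<le> enn2real (energy D f)"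
    (is "sum ?q _ \<le> _")
proof -
  have "ennreal (sum ?q {1..n}) \<le> energy D f"
    unfolding energy_def using p by (intro SUP_upper2[of "(n, p)"]) auto
  then have "enn2real (ennreal (sum ?q {1..n})) \<le> enn2real (energy D f)"
    using E by (intro enn2real_mono) auto
  moreover have "0 \<le> sum ?q {1..n}"
    using p by (intro sum_nonneg) (auto simp: unit_partition_def less_imp_le)
  ultimately show ?thesis by simp
qed

text \<open>The increment is a single term of the sum for a partition that contains \<open>s\<close>
  and \<open>t\<close>, and all other terms are nonnegative. It says that a path of finite energy is
  1/2-Hoelder.\<close>

lemma energy_increment_le:
  assumes E: "energy D f < \<infinity>" and st: "0 \<le> s" "s < t" "t \<le> 1"
  shows "(D (f t) (f s))\<^sup>2 \<le> (t - s) * enn2real (energy D f)"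
proof -
  have *: "(D (f (p i)) (f (p (i - 1))))\<^sup>2 \<le> (p i - p (i - 1)) * enn2real (energy D f)"
    if p: "unit_partition n p" and i: "i \<in> {1..n}" for n p i
  proof -
    let ?q = "\<lambda>i. (D (f (p i)) (f (p (i - 1))))\<^sup>2 / (p i - p (i - 1))"
    have pos: "p i - p (i - 1) > 0" if "i \<in> {1..n}" for i
      using p that by (auto simp: unit_partition_def)
    have "sum ?q {1..n} \<le> enn2real (energy D f)" by (rule energy_sum_le[OF E p])
    moreover have "?q i \<le> sum ?q {1..n}"
      using pos by (intro member_le_sum[OF i]) (auto simp: less_imp_le)
    ultimately have "?q i \<le> enn2real (energy D f)" by linarith
    then show ?thesis using pos[OF i] by (simp add: divide_le_eq mult.commute)
  qed
  have sets: "{1..2::nat} = {1, 2}" "{1..3::nat} = {1, 2, 3}" by auto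
  \<comment> \<open>Partitions are strictly increasing, so an endpoint that coincides with
    \<open>s\<close> or \<open>t\<close> must not be listed twice.\<close>
  consider "s = 0" "t = 1" | "s = 0" "t < 1" | "s > 0" "t = 1" | "s > 0" "t < 1" using st by linarith
  then show ?thesis
  proof cases
    case 1
    then show ?thesis using *[of 1 "\<lambda>i. if i = 0 then 0 else 1" 1] by (simp add: unit_partition_def)
  next
    case 2
    then have "unit_partition 2 (\<lambda>i. if i = 0 then 0 else if i = 1 then t else 1)"
      using st unfolding unit_partition_def sets by auto
    from *[OF this, of 1] show ?thesis using \<open>s = 0\<close> by simp
  next
    case 3
    then have "unit_partition 2 (\<lambda>i. if i = 0 then 0 else if i = 1 then s else 1)"
      using st unfolding unit_partition_def sets by auto
    from *[OF this, of 2] show ?thesis using \<open>t = 1\<close> by simp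
  next
    case 4
    then have "unit_partition 3 (\<lambda>i. if i = 0 then 0 else if i = 1 then s else if i = 2 then t else 1)"
      using st unfolding unit_partition_def sets by auto
    from *[OF this, of 2] show ?thesis by simp
  qed
qed

text \<open>If \<open>Inf {}\<close> is 0, the metric axioms hold and a continuous map takes values
  in the carrier. Otherwise a value that is no probability measure would have the fixed nonzero
  squared distance \<open>\<bar>Inf {}\<bar>\<close> from the values at all nearby times, against
  the Hoelder bound given by the finite energy.\<close>

lemma wasserstein_path_prob:
  fixes \<gamma> :: "real \<Rightarrow> 'a::compact_metric_space measure"
  assumes path: "wasserstein_path \<gamma>" and E: "energy wasserstein \<gamma> < \<infinity>" and t: "t \<in> {0..1}"
  shows "\<gamma> t \<in> space (prob_algebra borel)"
proof (cases "(Inf {} :: real) = 0")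
  case True
  interpret Metric_space "space (prob_algebra borel)" "wasserstein :: 'a measure \<Rightarrow> _"
    by (rule Metric_space_wasserstein) (simp add: True)
  have "\<gamma> \<in> topspace (top_of_set {0..1}) \<rightarrow> topspace mtopology"
    using path unfolding wasserstein_path_def pathin_def by (rule continuous_map_funspace)
  then show ?thesis using t by auto
next
  case False
  show ?thesis
  proof (rule ccontr)
    assume c: "\<gamma> t \<notin> space (prob_algebra borel)"
    define C where "C = enn2real (energy wasserstein \<gamma>)"
    have W: "(wasserstein (\<gamma> t) \<nu>)\<^sup>2 = \<bar>Inf {}\<bar>" "(wasserstein \<nu> (\<gamma> t))\<^sup>2 = \<bar>Inf {}\<bar>" for \<nu>
      using c couplings_empty[of "\<gamma> t" \<nu>] by (auto simp: wasserstein_sq)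
    have le: "\<bar>Inf {}\<bar> \<le> \<bar>t - s\<bar> * C" if "s \<in> {0..1}" "s \<noteq> t" for s
      using energy_increment_le[OF E, of s t] energy_increment_le[OF E, of t s] that t W
      by (cases "s < t") (auto simp: C_def)
    have C: "C \<ge> 0" by (simp add: C_def)
    \<comment> \<open>The bound 1/2 leaves t + e or t - e inside the unit interval; the other bound
      makes e C smaller than \<open>\<bar>Inf {}\<bar>\<close>. Using C + 1 avoids a zero
      denominator.\<close>
    define e where "e = min (1/2) (\<bar>Inf {} :: real\<bar> / (2 * (C + 1)))"
    have e: "0 < e" "e \<le> 1/2" "e * (C + 1) \<le> \<bar>Inf {}\<bar> / 2"
    proof -
      show "0 < e" using False C by (auto simp: e_def)
      show "e \<le> 1/2" unfolding e_def by (rule min.cobounded1)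
      have "e \<le> \<bar>Inf {} :: real\<bar> / (2 * (C + 1))" by (simp add: e_def)
      then show "e * (C + 1) \<le> \<bar>Inf {}\<bar> / 2" using C by (simp add: field_simps)
    qed
    define s where "s = (if t \<le> 1/2 then t + e else t - e)"
    have "s \<in> {0..1}" "s \<noteq> t" "\<bar>t - s\<bar> = e" using e t by (auto simp: s_def)
    then have "\<bar>Inf {} :: real\<bar> \<le> e * C" using le by metis
    also have "\<dots> \<le> e * (C + 1)" using e by simp
    finally show False using e False by linarith
  qed
qed

subsection \<open>Markov chains of near-optimal kernels\<close>

text \<open>The law of a Markov chain run for finitely many steps. All stages live on the same
  sequence space: each step overwrites one coordinate, and the coordinates not yet reached still
  hold the starting point.\<close>

primrec chain :: "'a::second_countable_topology measure \<Rightarrow> (nat \<Rightarrow> 'a \<Rightarrow> 'a measure) \<Rightarrow> nat \<Rightarrow> (nat \<Rightarrow> 'a) measure" where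
  "chain \<mu> \<kappa> 0 = distr \<mu> borel (\<lambda>x i. x)"
| "chain \<mu> \<kappa> (Suc n) = chain \<mu> \<kappa> n \<bind> (\<lambda>w. distr (\<kappa> n (w n)) borel (\<lambda>x. w(Suc n := x)))"

context
  fixes \<mu> :: "'a::second_countable_topology measure" and \<kappa> :: "nat \<Rightarrow> 'a \<Rightarrow> 'a measure"
  assumes \<mu>: "\<mu> \<in> space (prob_algebra borel)" and \<kappa>: "\<And>n. \<kappa> n \<in> borel \<rightarrow>\<^sub>M prob_algebra borel"
begin

lemma measurable_fun_upd_borel [measurable]:
  "(\<lambda>(w, x). w(n := x)) \<in> (borel \<Otimes>\<^sub>M borel) \<rightarrow>\<^sub>M (borel :: (nat \<Rightarrow> 'a) measure)"
  unfolding case_prod_beta' fun_upd_def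
proof (rule measurable_coordinatewise_then_product)
  fix i
  show "(\<lambda>p. if i = n then snd p else fst p i) \<in> borel_measurable ((borel :: (nat \<Rightarrow> 'a) measure) \<Otimes>\<^sub>M borel)"
    by (cases "i = n") (simp_all add: measurable_compose[OF measurable_fst measurable_product_coordinates])
qed

lemma chain_step_measurable:
  "(\<lambda>w. distr (\<kappa> n (w n)) borel (\<lambda>x. w(Suc n := x))) \<in> borel \<rightarrow>\<^sub>M prob_algebra borel"
proof (rule measurable_distr_prob_space2)
  show "(\<lambda>w :: nat \<Rightarrow> 'a. \<kappa> n (w n)) \<in> borel \<rightarrow>\<^sub>M prob_algebra borel"
    by (rule measurable_compose[OF measurable_product_coordinates \<kappa>])
qed measurable

lemma chain_prob: "chain \<mu> \<kappa> n \<in> space (prob_algebra borel)"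
proof (induction n)
  case 0
  have "(\<lambda>x (i::nat). x) \<in> borel_measurable \<mu>"
    by (rule measurable_coordinatewise_then_product) (use \<mu> in \<open>simp add: space_prob_algebra cong: measurable_cong_sets\<close>)
  then show ?case using \<mu> by (simp add: space_prob_algebra prob_space.prob_space_distr)
next
  case (Suc n)
  show ?case
    using prob_space_bind'[OF Suc chain_step_measurable] sets_bind'[OF Suc chain_step_measurable]
    by (simp add: space_prob_algebra)
qed

lemma kernel_prob: "prob_space (\<kappa> n x)" "sets (\<kappa> n x) = sets borel"
  using measurable_space[OF \<kappa>, of x n] by (auto simp: space_prob_algebra)

lemma nn_integral_chain_Suc:
  assumes f[measurable]: "f \<in> borel_measurable borel"
  shows "(\<integral>\<^sup>+w. f w \<partial>chain \<mu> \<kappa> (Suc n)) = (\<integral>\<^sup>+w. \<integral>\<^sup>+x. f (w(Suc n := x)) \<partial>\<kappa> n (w n) \<partial>chain \<mu> \<kappa> n)"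
proof -
  have s: "sets (chain \<mu> \<kappa> n) = sets borel" using chain_prob[of n] by (simp add: space_prob_algebra)
  have "(\<integral>\<^sup>+w. f w \<partial>chain \<mu> \<kappa> (Suc n))
    = (\<integral>\<^sup>+w. \<integral>\<^sup>+v. f v \<partial>distr (\<kappa> n (w n)) borel (\<lambda>x. w(Suc n := x)) \<partial>chain \<mu> \<kappa> n)"
    unfolding chain.simps
    by (rule nn_integral_bind[OF f]) (use measurable_prob_algebraD[OF chain_step_measurable] s in \<open>simp cong: measurable_cong_sets\<close>)
  also have "\<dots> = (\<integral>\<^sup>+w. \<integral>\<^sup>+x. f (w(Suc n := x)) \<partial>\<kappa> n (w n) \<partial>chain \<mu> \<kappa> n)"
  proof (intro nn_integral_cong nn_integral_distr)
    fix w :: "nat \<Rightarrow> 'a"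
    have "(\<lambda>x. w(Suc n := x)) \<in> borel_measurable borel"
      using measurable_compose[OF measurable_Pair1'[of w] measurable_fun_upd_borel[of "Suc n"]] by simp
    then show "(\<lambda>x. w(Suc n := x)) \<in> borel_measurable (\<kappa> n (w n))"
      using kernel_prob(2) by (simp cong: measurable_cong_sets)
  qed simp
  finally show ?thesis .
qed

text \<open>A later step overwrites a later coordinate only, and its kernel has total mass one. This
  lets a quantity of the finished chain be computed at the stage where it is decided.\<close>

lemma nn_integral_chain_past:
  assumes f: "f \<in> borel_measurable borel" and "\<And>w w'. (\<And>i. i \<le> m \<Longrightarrow> w i = w' i) \<Longrightarrow> f w = f w'" and "m \<le> n"
  shows "(\<integral>\<^sup>+w. f w \<partial>chain \<mu> \<kappa> n) = (\<integral>\<^sup>+w. f w \<partial>chain \<mu> \<kappa> m)"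
  using assms(3)
proof (induction n rule: dec_induct)
  case (step n)
  have "f (w(Suc n := x)) = f w" for w x using step by (intro assms(2)) auto
  then have "(\<integral>\<^sup>+w. f w \<partial>chain \<mu> \<kappa> (Suc n)) = (\<integral>\<^sup>+w. f w \<partial>chain \<mu> \<kappa> n)"
    unfolding nn_integral_chain_Suc[OF f] by (simp add: prob_space.emeasure_space_1[OF kernel_prob(1)])
  then show ?case using step by simp
qed simp

lemma distr_chain:
  assumes \<mu>s: "\<mu>s 0 = \<mu>" "\<And>i. \<mu>s i \<bind> \<kappa> i = \<mu>s (Suc i)" "\<And>i. \<mu>s i \<in> space (prob_algebra borel)"
  shows "distr (chain \<mu> \<kappa> n) borel (\<lambda>w. w n) = \<mu>s n"
proof (induction n)
  case 0
  have "sets \<mu> = sets borel" using \<mu> by (simp add: space_prob_algebra)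
  moreover have "(\<lambda>x (i::nat). x) \<in> borel_measurable \<mu>"
    by (rule measurable_coordinatewise_then_product) (use \<mu> in \<open>simp add: space_prob_algebra cong: measurable_cong_sets\<close>)
  ultimately show ?case by (simp add: distr_distr comp_def \<mu>s(1) distr_id2)
next
  case (Suc n)
  have s: "sets (chain \<mu> \<kappa> n) = sets borel" for n using chain_prob[of n] by (simp add: space_prob_algebra)
  note [measurable_cong] = s
  show ?case
  proof (rule measure_eqI)
    show "sets (distr (chain \<mu> \<kappa> (Suc n)) borel (\<lambda>w. w (Suc n))) = sets (\<mu>s (Suc n))"
      using \<mu>s(3)[of "Suc n"] by (simp add: space_prob_algebra)
    fix X assume "X \<in> sets (distr (chain \<mu> \<kappa> (Suc n)) borel (\<lambda>w. w (Suc n)))"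
    then have X[measurable]: "X \<in> sets borel" by simp
    have "emeasure (distr (chain \<mu> \<kappa> (Suc n)) borel (\<lambda>w. w (Suc n))) X
      = (\<integral>\<^sup>+x. indicator X x \<partial>distr (chain \<mu> \<kappa> (Suc n)) borel (\<lambda>w. w (Suc n)))" by simp
    also have "\<dots> = (\<integral>\<^sup>+w. indicator X (w (Suc n)) \<partial>chain \<mu> \<kappa> (Suc n))"
      by (rule nn_integral_distr) (auto cong: measurable_cong_sets simp del: chain.simps)
    also have "\<dots> = (\<integral>\<^sup>+w. emeasure (\<kappa> n (w n)) X \<partial>chain \<mu> \<kappa> n)"
      by (subst nn_integral_chain_Suc) (auto simp: kernel_prob)
    also have "\<dots> = (\<integral>\<^sup>+x. emeasure (\<kappa> n x) X \<partial>distr (chain \<mu> \<kappa> n) borel (\<lambda>w. w n))"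
      by (rule nn_integral_distr[symmetric])
        (auto cong: measurable_cong_sets intro!: measurable_emeasure_kernel measurable_prob_algebraD[OF \<kappa>])
    also have "\<dots> = emeasure (\<mu>s (Suc n)) X"
      unfolding Suc.IH using emeasure_bind_prob_algebra[OF \<mu>s(3)[of n] \<kappa>[of n] X] \<mu>s(2)[of n] by simp
    finally show "emeasure (distr (chain \<mu> \<kappa> (Suc n)) borel (\<lambda>w. w (Suc n))) X = emeasure (\<mu>s (Suc n)) X" .
  qed
qed

end

text \<open>The pair of coordinates \<open>i\<close> and \<open>Suc i\<close> is settled at stage
  \<open>Suc i\<close>, and there its cost is the kernel cost averaged over the marginal at
  \<open>i\<close>. No optimality is claimed for pairs that are further apart.\<close>

lemma near_optimal_chain:
  fixes \<mu>s :: "nat \<Rightarrow> 'a::compact_metric_space measure"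
  assumes \<mu>s: "\<And>i. \<mu>s i \<in> space (prob_algebra borel)" and e: "e > 0"
  obtains Q :: "(nat \<Rightarrow> 'a) measure" where "Q \<in> space (prob_algebra borel)"
    "\<And>i. i \<le> N \<Longrightarrow> distr Q borel (\<lambda>w. w i) = \<mu>s i"
    "\<And>i. i < N \<Longrightarrow> (\<integral>w. (dist (w (Suc i)) (w i))\<^sup>2 \<partial>Q) \<le> (wasserstein (\<mu>s (Suc i)) (\<mu>s i))\<^sup>2 + e"
proof -
  let ?P = "\<lambda>i \<kappa>. \<kappa> \<in> borel \<rightarrow>\<^sub>M prob_algebra borel \<and> \<mu>s i \<bind> \<kappa> = \<mu>s (Suc i) \<and>
    (\<integral>\<^sup>+y. \<integral>\<^sup>+x. ennreal ((dist x y)\<^sup>2) \<partial>\<kappa> y \<partial>\<mu>s i) \<le> ennreal ((wasserstein (\<mu>s (Suc i)) (\<mu>s i))\<^sup>2 + e)"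
  have "\<exists>\<kappa>. ?P i \<kappa>" for i
    by (rule near_optimal_kernel[OF \<mu>s[of "Suc i"] \<mu>s[of i] e]) blast
  then have "\<exists>\<kappa>. \<forall>i. ?P i (\<kappa> i)" by (intro choice) blast
  then obtain \<kappa> where \<kappa>: "\<And>i. \<kappa> i \<in> borel \<rightarrow>\<^sub>M prob_algebra borel" "\<And>i. \<mu>s i \<bind> \<kappa> i = \<mu>s (Suc i)"
    "\<And>i. (\<integral>\<^sup>+y. \<integral>\<^sup>+x. ennreal ((dist x y)\<^sup>2) \<partial>\<kappa> i y \<partial>\<mu>s i) \<le> ennreal ((wasserstein (\<mu>s (Suc i)) (\<mu>s i))\<^sup>2 + e)"
    by blast
  let ?Q = "chain (\<mu>s 0) \<kappa>"
  have cp: "?Q n \<in> space (prob_algebra borel)" for n by (rule chain_prob[OF \<mu>s \<kappa>(1)])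
  have s[measurable_cong]: "sets (?Q n) = sets borel" and p: "prob_space (?Q n)" for n
    using cp[of n] by (auto simp: space_prob_algebra)
  have marg: "distr (?Q i) borel (\<lambda>w. w i) = \<mu>s i" for i
    by (rule distr_chain[of "\<mu>s 0" \<kappa>, OF \<mu>s \<kappa>(1) refl \<kappa>(2) \<mu>s])
  show ?thesis
  proof (rule that[of "?Q N"])
    show "?Q N \<in> space (prob_algebra borel)" by (rule cp)
    fix i
    show "distr (?Q N) borel (\<lambda>w. w i) = \<mu>s i" if "i \<le> N"
    proof (rule measure_eqI)
      show "sets (distr (?Q N) borel (\<lambda>w. w i)) = sets (\<mu>s i)" using \<mu>s[of i] by (simp add: space_prob_algebra)
      fix X assume "X \<in> sets (distr (?Q N) borel (\<lambda>w. w i))"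
      then have [measurable]: "X \<in> sets borel" by simp
      have em: "emeasure (distr (?Q n) borel (\<lambda>w. w i)) X = (\<integral>\<^sup>+w. indicator X (w i) \<partial>?Q n)" for n
        by (subst nn_integral_distr[of "\<lambda>w. w i" _ borel "indicator X", symmetric])
          (auto cong: measurable_cong_sets[OF s refl])
      have "(\<integral>\<^sup>+w. indicator X (w i) \<partial>?Q N) = (\<integral>\<^sup>+w. indicator X (w i) \<partial>?Q i)"
        using that by (intro nn_integral_chain_past[of "\<mu>s 0" \<kappa>, OF \<mu>s \<kappa>(1)]) auto
      then show "emeasure (distr (?Q N) borel (\<lambda>w. w i)) X = emeasure (\<mu>s i) X"
        unfolding em by (metis em marg)
    qed
    assume i: "i < N"
    have m: "(\<lambda>w :: nat \<Rightarrow> 'a. w j) \<in> borel_measurable (?Q N)" for j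
      by (simp cong: measurable_cong_sets[OF s refl])
    have "integrable (?Q N) (\<lambda>w. (dist (w (Suc i)) (w i))\<^sup>2)"
      by (rule integrable_bounded_dist[OF p m m])
    then have "ennreal (\<integral>w. (dist (w (Suc i)) (w i))\<^sup>2 \<partial>?Q N) = (\<integral>\<^sup>+w. ennreal ((dist (w (Suc i)) (w i))\<^sup>2) \<partial>?Q N)"
      by (intro nn_integral_eq_integral[symmetric]) auto
    also have "\<dots> = (\<integral>\<^sup>+w. ennreal ((dist (w (Suc i)) (w i))\<^sup>2) \<partial>?Q (Suc i))"
      using i by (intro nn_integral_chain_past[of "\<mu>s 0" \<kappa>, OF \<mu>s \<kappa>(1)]) auto
    also have "\<dots> = (\<integral>\<^sup>+w. \<integral>\<^sup>+x. ennreal ((dist x (w i))\<^sup>2) \<partial>\<kappa> i (w i) \<partial>?Q i)"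
      by (subst nn_integral_chain_Suc[of "\<mu>s 0" \<kappa>, OF \<mu>s \<kappa>(1)]) auto
    also have "\<dots> = (\<integral>\<^sup>+y. \<integral>\<^sup>+x. ennreal ((dist x y)\<^sup>2) \<partial>\<kappa> i y \<partial>distr (?Q i) borel (\<lambda>w. w i))"
    proof (rule nn_integral_distr[symmetric])
      show "(\<lambda>w. w i) \<in> borel_measurable (?Q i)" by (simp cong: measurable_cong_sets[OF s refl])
      show "(\<lambda>y. \<integral>\<^sup>+x. ennreal ((dist x y)\<^sup>2) \<partial>\<kappa> i y) \<in> borel_measurable (distr (?Q i) borel (\<lambda>w. w i))"
        unfolding measurable_distr_eq1
        by (rule nn_integral_measurable_subprob_algebra2[OF _ measurable_prob_algebraD[OF \<kappa>(1)]]) measurable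
    qed
    also have "\<dots> \<le> ennreal ((wasserstein (\<mu>s (Suc i)) (\<mu>s i))\<^sup>2 + e)" unfolding marg by (rule \<kappa>(3))
    finally show "(\<integral>w. (dist (w (Suc i)) (w i))\<^sup>2 \<partial>?Q N) \<le> (wasserstein (\<mu>s (Suc i)) (\<mu>s i))\<^sup>2 + e"
      using e by (subst (asm) ennreal_le_iff) auto
  qed
qed

subsection \<open>Dyadic energies\<close>

text \<open>The triangle inequality followed by Cauchy-Schwarz; the factor is the number of
  steps.\<close>

lemma dist_sq_le_sum:
  fixes f :: "nat \<Rightarrow> 'a::metric_space"
  assumes "a \<le> b"
  shows "(dist (f b) (f a))\<^sup>2 \<le> real (b - a) * (\<Sum>i\<in>{a<..b}. (dist (f i) (f (i - 1)))\<^sup>2)"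
proof -
  have "dist (f b) (f a) \<le> (\<Sum>i\<in>{a<..b}. dist (f i) (f (i - 1)))"
    using assms
  proof (induction b rule: dec_induct)
    case (step n)
    have "{a<..Suc n} = insert (Suc n) {a<..n}" using step by auto
    then show ?case using step dist_triangle[of "f (Suc n)" "f a" "f n"] by simp
  qed simp
  then have "(dist (f b) (f a))\<^sup>2 \<le> (\<Sum>i\<in>{a<..b}. dist (f i) (f (i - 1)))\<^sup>2"
    by (intro power_mono) auto
  also have "\<dots> \<le> real (b - a) * (\<Sum>i\<in>{a<..b}. (dist (f i) (f (i - 1)))\<^sup>2)"
    using sum_squared_le_sum_of_squares[of "\<lambda>i. dist (f i) (f (i - 1))" "{a<..b}"] by (simp add: mult.commute)
  finally show ?thesis .
qed

text \<open>Each term is estimated by the unit steps inside its own block, and the blocks are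
  disjoint. Equal neighbours are allowed since \<open>a\<close> will arise by rounding distinct
  times to a grid.\<close>

lemma sum_steps_le:
  fixes f :: "nat \<Rightarrow> 'a::metric_space" and a :: "nat \<Rightarrow> nat"
  assumes "a 0 = 0" "\<And>j. j \<in> {1..n} \<Longrightarrow> a (j - 1) \<le> a j"
  shows "(\<Sum>j=1..n. (dist (f (a j)) (f (a (j - 1))))\<^sup>2 / (real (a j) - real (a (j - 1))))
    \<le> (\<Sum>i=1..a n. (dist (f i) (f (i - 1)))\<^sup>2)"
  using assms(2)
proof (induction n)
  case 0
  then show ?case using assms(1) by simp
next
  case (Suc n)
  have le: "a n \<le> a (Suc n)" using Suc.prems[of "Suc n"] by simp
  let ?g = "\<lambda>i. (dist (f i) (f (i - 1)))\<^sup>2"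
  have "(dist (f (a (Suc n))) (f (a n)))\<^sup>2 / (real (a (Suc n)) - real (a n)) \<le> (\<Sum>i\<in>{a n<..a (Suc n)}. ?g i)"
  \<comment> \<open>An empty block contributes 0, because division by zero yields zero.\<close>
  proof (cases "a n = a (Suc n)")
    case False
    then have "real (a (Suc n)) - real (a n) > 0" using le by simp
    then show ?thesis
      using dist_sq_le_sum[OF le, of f] le by (simp add: pos_divide_le_eq of_nat_diff mult.commute)
  qed simp
  moreover have "(\<Sum>i=1..a (Suc n). ?g i) = (\<Sum>i=1..a n. ?g i) + (\<Sum>i\<in>{a n<..a (Suc n)}. ?g i)"
  proof -
    have "{1..a (Suc n)} = {1..a n} \<union> {a n<..a (Suc n)}" using le by auto
    moreover have "sum ?g ({1..a n} \<union> {a n<..a (Suc n)}) = sum ?g {1..a n} + sum ?g {a n<..a (Suc n)}"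
      by (intro sum.union_disjoint) auto
    ultimately show ?thesis by (simp only:)
  qed
  moreover have "(\<Sum>j=1..n. (dist (f (a j)) (f (a (j - 1))))\<^sup>2 / (real (a j) - real (a (j - 1)))) \<le> (\<Sum>i=1..a n. ?g i)"
    using Suc.prems by (intro Suc.IH) auto
  ultimately show ?case by simp
qed

text \<open>Rational indices keep the path space a countable product, and a time that occurs on
  several levels is one and the same index.\<close>

definition dyad :: "nat \<Rightarrow> nat \<Rightarrow> rat" where
  "dyad n i = of_nat i / 2 ^ n"

text \<open>The energy sum of a single path along the uniform partition; the factor
  \<open>2 ^ n\<close> is the inverse of its mesh.\<close>

definition dyadic_energy :: "nat \<Rightarrow> (rat \<Rightarrow> 'a::metric_space) \<Rightarrow> real" where
  "dyadic_energy n w = 2 ^ n * (\<Sum>i=1..2 ^ n. (dist (w (dyad n i)) (w (dyad n (i - 1))))\<^sup>2)"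

lemma dyad_refine: "dyad (n + k) (2 ^ k * i) = dyad n i"
  by (simp add: dyad_def power_add)

lemma dyadic_energy_nonneg: "0 \<le> dyadic_energy n w"
  by (simp add: dyadic_energy_def sum_nonneg)

text \<open>The common source of two facts: monotonicity in the level, where \<open>a\<close> runs
  through multiples of a power of 2, and the bound for arbitrary partitions, where \<open>a\<close>
  consists of rounded times.\<close>

lemma dyadic_steps_le:
  fixes a :: "nat \<Rightarrow> nat" and w :: "rat \<Rightarrow> 'a::metric_space"
  assumes "a 0 = 0" "a n = 2 ^ k" "\<And>j. j \<in> {1..n} \<Longrightarrow> a (j - 1) \<le> a j"
  shows "(\<Sum>j=1..n. (dist (w (dyad k (a j))) (w (dyad k (a (j - 1)))))\<^sup>2 / (real (a j) / 2 ^ k - real (a (j - 1)) / 2 ^ k))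
    \<le> dyadic_energy k w"
proof -
  have "(\<Sum>j=1..n. (dist (w (dyad k (a j))) (w (dyad k (a (j - 1)))))\<^sup>2 / (real (a j) / 2 ^ k - real (a (j - 1)) / 2 ^ k))
     = 2 ^ k * (\<Sum>j=1..n. (dist (w (dyad k (a j))) (w (dyad k (a (j - 1)))))\<^sup>2 / (real (a j) - real (a (j - 1))))"
    unfolding sum_distrib_left by (rule sum.cong) (auto simp: diff_divide_distrib[symmetric])
  also have "\<dots> \<le> 2 ^ k * (\<Sum>i=1..a n. (dist (w (dyad k i)) (w (dyad k (i - 1))))\<^sup>2)"
    by (intro mult_left_mono sum_steps_le[of a n "\<lambda>i. w (dyad k i)"] assms) auto
  finally show ?thesis by (simp add: dyadic_energy_def assms(2))
qed

lemma dyadic_energy_mono: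
  assumes "m \<le> n"
  shows "dyadic_energy m w \<le> dyadic_energy n w"
proof -
  define k where "k = n - m"
  have n: "n = m + k" using assms by (simp add: k_def)
  have "dyadic_energy m w = (\<Sum>j=1..2 ^ m. (dist (w (dyad n (2 ^ k * j))) (w (dyad n (2 ^ k * (j - 1)))))\<^sup>2
      / (real (2 ^ k * j) / 2 ^ n - real (2 ^ k * (j - 1)) / 2 ^ n))"
    unfolding dyadic_energy_def sum_distrib_left n dyad_refine
  proof (rule sum.cong[OF refl])
    fix j assume "j \<in> {1..2 ^ m::nat}"
    then have "real (2 ^ k * j) / 2 ^ (m + k) - real (2 ^ k * (j - 1)) / 2 ^ (m + k) = 1 / 2 ^ m"
      by (simp add: power_add of_nat_diff field_simps)
    then show "2 ^ m * (dist (w (dyad m j)) (w (dyad m (j - 1))))\<^sup>2 = (dist (w (dyad m j)) (w (dyad m (j - 1))))\<^sup>2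
      / (real (2 ^ k * j) / 2 ^ (m + k) - real (2 ^ k * (j - 1)) / 2 ^ (m + k))" by simp
  qed
  also have "\<dots> \<le> dyadic_energy n w"
    by (rule dyadic_steps_le) (auto simp: n power_add)
  finally show ?thesis .
qed

lemma dyadic_dist_sq_le:
  assumes "a \<le> b" "b \<le> 2 ^ k"
  shows "(dist (w (dyad k b)) (w (dyad k a)))\<^sup>2 \<le> (real b / 2 ^ k - real a / 2 ^ k) * dyadic_energy k w"
proof -
  let ?g = "\<lambda>i. (dist (w (dyad k i)) (w (dyad k (i - 1))))\<^sup>2"
  have "(dist (w (dyad k b)) (w (dyad k a)))\<^sup>2 \<le> real (b - a) * (\<Sum>i\<in>{a<..b}. ?g i)"
    by (rule dist_sq_le_sum[OF assms(1), of "\<lambda>i. w (dyad k i)"])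
  also have "\<dots> \<le> real (b - a) * (\<Sum>i=1..2 ^ k. ?g i)"
    using assms by (intro mult_left_mono sum_mono2) auto
  also have "\<dots> = (real b / 2 ^ k - real a / 2 ^ k) * dyadic_energy k w"
    using assms by (simp add: dyadic_energy_def of_nat_diff field_simps)
  finally show ?thesis .
qed

lemma borel_measurable_dyadic_energy [measurable]:
  "dyadic_energy n \<in> borel_measurable (borel :: (rat \<Rightarrow> 'a::compact_metric_space) measure)"
  unfolding dyadic_energy_def by measurable

text \<open>Makes the energy of a fixed level an admissible test function for
  \<open>weak_seq_compact\<close>.\<close>

lemma continuous_on_dyadic_energy:
  "continuous_on UNIV (dyadic_energy n :: (rat \<Rightarrow> 'a::compact_metric_space) \<Rightarrow> real)"
  unfolding dyadic_energy_def by (intro continuous_intros continuous_on_product_coordinates)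

lemma integrable_dyadic_energy:
  fixes P :: "(rat \<Rightarrow> 'a::compact_metric_space) measure"
  assumes "P \<in> space (prob_algebra borel)"
  shows "integrable P (dyadic_energy n)"
proof -
  have p: "prob_space P" and [measurable_cong]: "sets P = sets borel"
    using assms by (auto simp: space_prob_algebra)
  show ?thesis
    unfolding dyadic_energy_def
    by (intro integrable_mult_right Bochner_Integration.integrable_sum integrable_bounded_dist[OF p]) measurable
qed

section \<open>Laws on the dyadic times with controlled energy\<close>

lemma approximate_dyadic_law:
  fixes \<gamma> :: "real \<Rightarrow> 'a::compact_metric_space measure"
  assumes \<gamma>: "\<And>t. t \<in> {0..1} \<Longrightarrow> \<gamma> t \<in> space (prob_algebra borel)"
    and E: "energy wasserstein \<gamma> < \<infinity>"
  obtains P :: "(rat \<Rightarrow> 'a) measure" where "P \<in> space (prob_algebra borel)"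
    "\<And>m i. m \<le> n \<Longrightarrow> i \<le> 2 ^ m \<Longrightarrow> distr P borel (\<lambda>w. w (dyad m i)) = \<gamma> (real i / 2 ^ m)"
    "(\<integral>w. dyadic_energy n w \<partial>P) \<le> enn2real (energy wasserstein \<gamma>) + (1 / 2) ^ n"
proof -
  \<comment> \<open>The chain lemma takes an infinite sequence of probability measures, so times
    beyond 1 are cut back to 1.\<close>
  define \<mu>s where "\<mu>s i = \<gamma> (min 1 (real i / 2 ^ n))" for i
  have \<mu>s: "\<mu>s i \<in> space (prob_algebra borel)" for i unfolding \<mu>s_def by (rule \<gamma>) auto
  have \<mu>s_eq: "\<mu>s i = \<gamma> (real i / 2 ^ n)" if "i \<le> 2 ^ n" for i
  proof -
    have "real i / 2 ^ n \<le> 1" using of_nat_mono[OF that, where 'a=real] by simp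
    then show ?thesis unfolding \<mu>s_def by (simp only: min_absorb2)
  qed
  have e: "(1 / 8 :: real) ^ n > 0" by simp
  obtain Q :: "(nat \<Rightarrow> 'a) measure" where Q: "Q \<in> space (prob_algebra borel)"
    "\<And>i. i \<le> 2 ^ n \<Longrightarrow> distr Q borel (\<lambda>w. w i) = \<mu>s i"
    "\<And>i. i < 2 ^ n \<Longrightarrow> (\<integral>w. (dist (w (Suc i)) (w i))\<^sup>2 \<partial>Q) \<le> (wasserstein (\<mu>s (Suc i)) (\<mu>s i))\<^sup>2 + (1 / 8) ^ n"
    using near_optimal_chain[where \<mu>s=\<mu>s and N="2 ^ n", OF \<mu>s e] by blast
  have p: "prob_space Q" and s[measurable_cong]: "sets Q = sets borel"
    using Q(1) by (auto simp: space_prob_algebra)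
  \<comment> \<open>The sequence is spread over all rationals by rounding down to the grid of level
    n; at dyadic times of level at most n in the unit interval the rounding is exact.\<close>
  define T where "T w q = w (nat \<lfloor>q * 2 ^ n\<rfloor>)" for w :: "nat \<Rightarrow> 'a" and q :: rat
  have T: "T w (dyad m i) = w (i * 2 ^ (n - m))" if "m \<le> n" for w m i
  proof -
    have "dyad m i * 2 ^ n = of_int (int (i * 2 ^ (n - m)))"
    proof -
      have "(2 :: rat) ^ n = 2 ^ m * 2 ^ (n - m)" using that by (simp add: power_add[symmetric])
      then show ?thesis by (simp add: dyad_def)
    qed
    then show ?thesis unfolding T_def by (metis floor_of_int nat_int)
  qed
  have [measurable]: "T \<in> borel_measurable borel"
    by (rule measurable_coordinatewise_then_product) (simp add: T_def)
  show ?thesis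
  proof (rule that[of "distr Q borel T"])
    show "distr Q borel T \<in> space (prob_algebra borel)"
      by (auto simp: space_prob_algebra intro!: prob_space.prob_space_distr[OF p])
    fix m i assume mi: "m \<le> n" "i \<le> (2::nat) ^ m"
    have "i * 2 ^ (n - m) \<le> 2 ^ m * 2 ^ (n - m)" using mi(2) by (rule mult_right_mono) simp
    then have le: "i * 2 ^ (n - m) \<le> 2 ^ n" using mi(1) by (simp add: power_add[symmetric])
    have "distr (distr Q borel T) borel (\<lambda>w. w (dyad m i)) = distr Q borel (\<lambda>w. w (i * 2 ^ (n - m)))"
      by (subst distr_distr) (auto simp: comp_def T[OF mi(1)])
    also have "\<dots> = \<gamma> (real (i * 2 ^ (n - m)) / 2 ^ n)" using Q(2)[OF le] \<mu>s_eq[OF le] by simp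
    also have "real (i * 2 ^ (n - m)) / 2 ^ n = real i / 2 ^ m"
    proof -
      have "(2 :: real) ^ n = 2 ^ m * 2 ^ (n - m)" using mi(1) by (simp add: power_add[symmetric])
      then show ?thesis by simp
    qed
    finally show "distr (distr Q borel T) borel (\<lambda>w. w (dyad m i)) = \<gamma> (real i / 2 ^ m)" .
  next
    define W where "W i = (wasserstein (\<gamma> (real i / 2 ^ n)) (\<gamma> (real (i - 1) / 2 ^ n)))\<^sup>2" for i
    have up: "unit_partition (2 ^ n) (\<lambda>i. real i / 2 ^ n)"
      by (auto simp: unit_partition_def divide_strict_right_mono)
    have "(\<Sum>i=1..2 ^ n. W i / (real i / 2 ^ n - real (i - 1) / 2 ^ n)) = 2 ^ n * (\<Sum>i=1..2 ^ n. W i)"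
      unfolding sum_distrib_left by (rule sum.cong) (auto simp: of_nat_diff field_simps)
    then have WE: "2 ^ n * (\<Sum>i=1..2 ^ n. W i) \<le> enn2real (energy wasserstein \<gamma>)"
      using energy_sum_le[OF E up] by (simp add: W_def)
    have int: "integrable Q (\<lambda>w. (dist (w i) (w j))\<^sup>2)" for i j
      by (rule integrable_bounded_dist[OF p]) measurable
    have "(\<integral>w. dyadic_energy n w \<partial>distr Q borel T) = (\<integral>w. dyadic_energy n (T w) \<partial>Q)"
      by (rule integral_distr) measurable
    also have "\<dots> = (\<integral>w. 2 ^ n * (\<Sum>i=1..2 ^ n. (dist (w i) (w (i - 1)))\<^sup>2) \<partial>Q)"
      unfolding dyadic_energy_def T[OF order_refl] by simp
    also have "\<dots> = 2 ^ n * (\<Sum>i=1..2 ^ n. \<integral>w. (dist (w i) (w (i - 1)))\<^sup>2 \<partial>Q)"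
      using int by simp
    also have "\<dots> \<le> 2 ^ n * (\<Sum>i=1..2 ^ n. W i + (1 / 8) ^ n)"
    proof (intro mult_left_mono sum_mono)
      fix i assume i: "i \<in> {1..2 ^ n::nat}"
      then obtain j where j: "i = Suc j" by (cases i) auto
      then show "(\<integral>w. (dist (w i) (w (i - 1)))\<^sup>2 \<partial>Q) \<le> W i + (1 / 8) ^ n"
        using Q(3)[of j] i \<mu>s_eq[of j] \<mu>s_eq[of "Suc j"] by (simp add: W_def)
    qed simp
    also have "\<dots> = 2 ^ n * (\<Sum>i=1..2 ^ n. W i) + 2 ^ n * 2 ^ n * (1 / 8) ^ n"
      by (simp add: sum.distrib algebra_simps)
    also have "2 ^ n * 2 ^ n * (1 / 8) ^ n = (1 / 2 :: real) ^ n"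
      by (simp add: power_mult_distrib[symmetric])
    finally show "(\<integral>w. dyadic_energy n w \<partial>distr Q borel T) \<le> enn2real (energy wasserstein \<gamma>) + (1 / 2) ^ n"
      using WE by simp
  qed
qed

text \<open>For a fixed level m, all approximating laws of level at least m have the prescribed
  marginals there, and their expected level-m energy is controlled by monotonicity. Both properties
  pass to a weak limit.\<close>

lemma dyadic_law:
  fixes \<gamma> :: "real \<Rightarrow> 'a::compact_metric_space measure"
  assumes \<gamma>: "\<And>t. t \<in> {0..1} \<Longrightarrow> \<gamma> t \<in> space (prob_algebra borel)"
    and E: "energy wasserstein \<gamma> < \<infinity>"
  obtains P :: "(rat \<Rightarrow> 'a) measure" where "P \<in> space (prob_algebra borel)"
    "\<And>m i. i \<le> 2 ^ m \<Longrightarrow> distr P borel (\<lambda>w. w (dyad m i)) = \<gamma> (real i / 2 ^ m)"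
    "\<And>m. (\<integral>w. dyadic_energy m w \<partial>P) \<le> enn2real (energy wasserstein \<gamma>)"
proof -
  let ?C = "enn2real (energy wasserstein \<gamma>)"
  let ?A = "\<lambda>n P. P \<in> space (prob_algebra (borel :: (rat \<Rightarrow> 'a) measure)) \<and>
    (\<forall>m i. m \<le> n \<longrightarrow> i \<le> 2 ^ m \<longrightarrow> distr P borel (\<lambda>w. w (dyad m i)) = \<gamma> (real i / 2 ^ m)) \<and>
    (\<integral>w. dyadic_energy n w \<partial>P) \<le> ?C + (1 / 2) ^ n"
  have "\<exists>P. ?A n P" for n
    by (rule approximate_dyadic_law[of \<gamma> n, OF \<gamma> E]) blast+
  then have "\<exists>P. \<forall>n. ?A n (P n)" by (intro choice) blast
  then obtain P where P: "\<And>n. P n \<in> space (prob_algebra (borel :: (rat \<Rightarrow> 'a) measure))"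
    "\<And>n m i. m \<le> n \<Longrightarrow> i \<le> 2 ^ m \<Longrightarrow> distr (P n) borel (\<lambda>w. w (dyad m i)) = \<gamma> (real i / 2 ^ m)"
    "\<And>n. (\<integral>w. dyadic_energy n w \<partial>P n) \<le> ?C + (1 / 2) ^ n" by blast
  obtain r L where r: "strict_mono r" and L: "L \<in> space (prob_algebra (borel :: (rat \<Rightarrow> 'a) measure))"
    and lim: "\<And>f :: (rat \<Rightarrow> 'a) \<Rightarrow> real. continuous_on UNIV f \<Longrightarrow> (\<lambda>k. \<integral>x. f x \<partial>P (r k)) \<longlonglongrightarrow> (\<integral>x. f x \<partial>L)"
    using weak_seq_compact[of P, OF compact_UNIV_fun P(1)] by blast
  have [measurable_cong]: "sets (P n) = sets borel" "sets L = sets borel" for n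
    using P(1)[of n] L by (auto simp: space_prob_algebra)
  show ?thesis
  proof (rule that[of L])
    show "L \<in> space (prob_algebra borel)" by fact
    fix m
    show "distr L borel (\<lambda>w. w (dyad m i)) = \<gamma> (real i / 2 ^ m)" if i: "i \<le> 2 ^ m" for i
    proof (rule measure_eqI_lipschitz)
      have "real i \<le> 2 ^ m" using of_nat_mono[OF i, where 'a=real] by simp
      then show "\<gamma> (real i / 2 ^ m) \<in> space (prob_algebra borel)" by (intro \<gamma>) auto
      show "distr L borel (\<lambda>w. w (dyad m i)) \<in> space (prob_algebra borel)"
        using L by (auto simp: space_prob_algebra intro!: prob_space.prob_space_distr)
      fix f :: "'a \<Rightarrow> real" and c assume c: "c > 0" and f: "\<And>x y. \<bar>f x - f y\<bar> \<le> c * dist x y"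
      have fc: "continuous_on UNIV f"
        using f c by (intro lipschitz_on_continuous_on[of c] lipschitz_onI) (auto simp: dist_real_def)
      then have [measurable]: "f \<in> borel_measurable borel" by (rule borel_measurable_continuous_onI)
      have "continuous_on UNIV (\<lambda>w :: rat \<Rightarrow> 'a. f (w (dyad m i)))"
        by (rule continuous_on_compose2[OF fc continuous_on_product_coordinates]) simp
      from lim[OF this] have "(\<lambda>k. \<integral>w. f (w (dyad m i)) \<partial>P (r k)) \<longlonglongrightarrow> (\<integral>w. f (w (dyad m i)) \<partial>L)" .
      \<comment> \<open>The sequence of test integrals is eventually constant, which identifies its
        limit.\<close>
      moreover have "(\<integral>w. f (w (dyad m i)) \<partial>P (r k)) = (\<integral>x. f x \<partial>\<gamma> (real i / 2 ^ m))" if "k \<ge> m" for k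
      proof -
        have "m \<le> r k" using that seq_suble[OF r, of k] by linarith
        have "(\<integral>w. f (w (dyad m i)) \<partial>P (r k)) = (\<integral>x. f x \<partial>distr (P (r k)) borel (\<lambda>w. w (dyad m i)))"
          by (rule integral_distr[symmetric]) measurable
        then show ?thesis unfolding P(2)[OF \<open>m \<le> r k\<close> i] .
      qed
      then have "eventually (\<lambda>k. (\<integral>w. f (w (dyad m i)) \<partial>P (r k)) = (\<integral>x. f x \<partial>\<gamma> (real i / 2 ^ m))) sequentially"
        by (auto simp: eventually_sequentially)
      then have "(\<lambda>k. \<integral>w. f (w (dyad m i)) \<partial>P (r k)) \<longlonglongrightarrow> (\<integral>x. f x \<partial>\<gamma> (real i / 2 ^ m))"
        by (rule tendsto_eventually)
      ultimately have "(\<integral>w. f (w (dyad m i)) \<partial>L) = (\<integral>x. f x \<partial>\<gamma> (real i / 2 ^ m))" by (rule LIMSEQ_unique)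
      then show "(\<integral>x. f x \<partial>distr L borel (\<lambda>w. w (dyad m i))) = (\<integral>x. f x \<partial>\<gamma> (real i / 2 ^ m))"
        by (simp add: integral_distr)
    qed
    show "(\<integral>w. dyadic_energy m w \<partial>L) \<le> ?C"
    proof (rule LIMSEQ_le[OF lim[OF continuous_on_dyadic_energy]])
      show "(\<lambda>k. ?C + (1 / 2) ^ k) \<longlonglongrightarrow> ?C"
        using tendsto_add[OF tendsto_const LIMSEQ_realpow_zero[of "1/2::real"], of ?C] by simp
      \<comment> \<open>Here m <= k <= r k: the energy of level m is compared with that of level r
        k, for which this law was built.\<close>
      have "(\<integral>w. dyadic_energy m w \<partial>P (r k)) \<le> ?C + (1 / 2) ^ k" if "k \<ge> m" for k
      proof -
        have rk: "k \<le> r k" by (rule seq_suble[OF r])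
        have "(\<integral>w. dyadic_energy m w \<partial>P (r k)) \<le> (\<integral>w. dyadic_energy (r k) w \<partial>P (r k))"
          using rk that by (intro integral_mono integrable_dyadic_energy P dyadic_energy_mono) auto
        also have "\<dots> \<le> ?C + (1 / 2) ^ r k" by (rule P)
        also have "(1 / 2 :: real) ^ r k \<le> (1 / 2) ^ k" using rk by (intro power_decreasing) auto
        finally show ?thesis by simp
      qed
      then show "\<exists>N. \<forall>k\<ge>N. (\<integral>w. dyadic_energy m w \<partial>P (r k)) \<le> ?C + (1 / 2) ^ k" by blast
    qed
  qed
qed

subsection \<open>The limit process\<close>

definition dyadic_floor :: "nat \<Rightarrow> real \<Rightarrow> nat" where
  "dyadic_floor k t = nat \<lfloor>t * 2 ^ k\<rfloor>"

definition dyadic_approx :: "nat \<Rightarrow> real \<Rightarrow> (rat \<Rightarrow> 'a) \<Rightarrow> 'a" where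
  "dyadic_approx k t w = w (dyad k (dyadic_floor k t))"

lemma dyadic_floor_bounds:
  assumes "0 \<le> t"
  shows "real (dyadic_floor k t) \<le> t * 2 ^ k" "t * 2 ^ k < real (dyadic_floor k t) + 1"
proof -
  have "0 \<le> t * 2 ^ k" using assms by simp
  then have "real (dyadic_floor k t) = of_int \<lfloor>t * 2 ^ k\<rfloor>" by (simp add: dyadic_floor_def)
  then show "real (dyadic_floor k t) \<le> t * 2 ^ k" "t * 2 ^ k < real (dyadic_floor k t) + 1" by linarith+
qed

lemma dyadic_floor_mono: "s \<le> t \<Longrightarrow> dyadic_floor k s \<le> dyadic_floor k t"
  unfolding dyadic_floor_def by (intro nat_mono floor_mono mult_right_mono) auto

text \<open>Both endpoints are rounded exactly, so a rounded partition still has the ends that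
  \<open>dyadic_steps_le\<close> asks for.\<close>

lemma dyadic_floor_0_1 [simp]: "dyadic_floor k 0 = 0" "dyadic_floor k 1 = 2 ^ k"
proof -
  show "dyadic_floor k 0 = 0" by (simp add: dyadic_floor_def)
  have "(2::real) ^ k = of_int (2 ^ k)" by simp
  then show "dyadic_floor k 1 = 2 ^ k" unfolding dyadic_floor_def by (metis floor_of_int mult_1 nat_numeral nat_power_eq zero_le_numeral)
qed

lemma dyadic_floor_le: "t \<le> 1 \<Longrightarrow> dyadic_floor k t \<le> 2 ^ k"
  using dyadic_floor_mono[of t 1 k] by simp

lemma dyadic_floor_tendsto:
  assumes "0 \<le> t"
  shows "(\<lambda>k. real (dyadic_floor k t) / 2 ^ k) \<longlonglongrightarrow> t"
proof (rule tendsto_sandwich)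
  show "\<forall>\<^sub>F k in sequentially. t - (1 / 2) ^ k \<le> real (dyadic_floor k t) / 2 ^ k"
  proof (intro always_eventually allI)
    fix k
    have "t \<le> (real (dyadic_floor k t) + 1) / 2 ^ k"
      using dyadic_floor_bounds(2)[OF assms, of k] by (simp add: pos_le_divide_eq less_imp_le)
    then show "t - (1 / 2) ^ k \<le> real (dyadic_floor k t) / 2 ^ k" by (simp add: add_divide_distrib power_one_over)
  qed
  show "\<forall>\<^sub>F k in sequentially. real (dyadic_floor k t) / 2 ^ k \<le> t"
    using dyadic_floor_bounds(1)[OF assms] by (intro always_eventually allI) (simp add: field_simps)
  show "(\<lambda>k. t - (1 / 2) ^ k) \<longlonglongrightarrow> t"
    using tendsto_diff[OF tendsto_const LIMSEQ_realpow_zero[of "1/2::real"], of t] by simp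
qed simp

text \<open>Asking for a natural number as bound presents the set as a countable union of countable
  intersections, hence as a Borel set.\<close>

definition finite_energy_paths :: "(rat \<Rightarrow> 'a::metric_space) set" where
  "finite_energy_paths = {w. \<exists>C::nat. \<forall>k. dyadic_energy k w \<le> real C}"

lemma dyadic_approx_dist_sq_le:
  assumes "0 \<le> s" "s \<le> t" "t \<le> 1" and C: "\<And>k. dyadic_energy k w \<le> C"
  shows "(dist (dyadic_approx k t w) (dyadic_approx k s w))\<^sup>2 \<le> (real (dyadic_floor k t) / 2 ^ k - real (dyadic_floor k s) / 2 ^ k) * C"
proof -
  have le: "dyadic_floor k s \<le> dyadic_floor k t" using assms by (intro dyadic_floor_mono)
  have "(dist (dyadic_approx k t w) (dyadic_approx k s w))\<^sup>2 \<le> (real (dyadic_floor k t) / 2 ^ k - real (dyadic_floor k s) / 2 ^ k) * dyadic_energy k w"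
    unfolding dyadic_approx_def using le assms by (intro dyadic_dist_sq_le dyadic_floor_le)
  also have "\<dots> \<le> (real (dyadic_floor k t) / 2 ^ k - real (dyadic_floor k s) / 2 ^ k) * C"
    using le by (intro mult_left_mono C) (simp add: divide_right_mono)
  finally show ?thesis .
qed

text \<open>Rounding \<open>t\<close> on a coarse and on a finer level gives grid times at most one
  coarse mesh apart, and both belong to the finer grid, where the Hoelder bound applies. This makes
  the approximations Cauchy.\<close>

lemma dyadic_approx_refine_dist_sq_le:
  assumes t: "0 \<le> t" "t \<le> 1" and C: "\<And>k. dyadic_energy k w \<le> C" and "k \<le> l"
  shows "(dist (dyadic_approx l t w) (dyadic_approx k t w))\<^sup>2 \<le> (1 / 2) ^ k * C"
proof -
  define j where "j = l - k"
  have l: "l = k + j" using \<open>k \<le> l\<close> by (simp add: j_def)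
  \<comment> \<open>The coarse rounding, written as a multiple of \<open>2 ^ j\<close> on the grid
    of level \<open>l\<close>.\<close>
  have r: "real (2 ^ j * dyadic_floor k t) \<le> t * 2 ^ l" "t * 2 ^ l < 2 ^ j * real (dyadic_floor k t) + 2 ^ j"
  proof -
    have *: "t * 2 ^ l = 2 ^ j * (t * 2 ^ k)" by (simp add: l power_add)
    show "real (2 ^ j * dyadic_floor k t) \<le> t * 2 ^ l"
      unfolding * using dyadic_floor_bounds(1)[OF t(1), of k] by simp
    have "2 ^ j * (t * 2 ^ k) < 2 ^ j * (real (dyadic_floor k t) + 1)"
      using dyadic_floor_bounds(2)[OF t(1), of k] by simp
    then show "t * 2 ^ l < 2 ^ j * real (dyadic_floor k t) + 2 ^ j" unfolding * by (simp add: algebra_simps)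
  qed
  have le: "2 ^ j * dyadic_floor k t \<le> dyadic_floor l t"
  proof -
    have "real (2 ^ j * dyadic_floor k t) < real (dyadic_floor l t) + 1" using r(1) dyadic_floor_bounds(2)[OF t(1), of l] by linarith
    then show ?thesis by linarith
  qed
  have "(dist (dyadic_approx l t w) (dyadic_approx k t w))\<^sup>2 = (dist (w (dyad l (dyadic_floor l t))) (w (dyad l (2 ^ j * dyadic_floor k t))))\<^sup>2"
    unfolding dyadic_approx_def l dyad_refine ..
  also have "\<dots> \<le> (real (dyadic_floor l t) / 2 ^ l - real (2 ^ j * dyadic_floor k t) / 2 ^ l) * dyadic_energy l w"
    by (rule dyadic_dist_sq_le[OF le dyadic_floor_le[OF t(2)]])
  also have "\<dots> \<le> (1 / 2) ^ k * C"
  proof (rule mult_mono)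
    have "real (dyadic_floor l t) - real (2 ^ j * dyadic_floor k t) \<le> 2 ^ j"
      using r(2) dyadic_floor_bounds(1)[OF t(1), of l] by simp
    then have "(real (dyadic_floor l t) - real (2 ^ j * dyadic_floor k t)) / 2 ^ l \<le> 2 ^ j / 2 ^ l"
      by (rule divide_right_mono) simp
    also have "(2 :: real) ^ j / 2 ^ l = (1 / 2) ^ k" by (simp add: l power_add power_one_over)
    finally show "real (dyadic_floor l t) / 2 ^ l - real (2 ^ j * dyadic_floor k t) / 2 ^ l \<le> (1 / 2) ^ k"
      by (simp add: diff_divide_distrib)
  qed (use C dyadic_energy_nonneg in auto)
  finally show ?thesis .
qed

lemma dyadic_approx_convergent:
  fixes w :: "rat \<Rightarrow> 'a::compact_metric_space"
  assumes w: "w \<in> finite_energy_paths" and t: "t \<in> {0..1}"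
  shows "(\<lambda>k. dyadic_approx k t w) \<longlonglongrightarrow> lim (\<lambda>k. dyadic_approx k t w)"
proof -
  obtain C where C: "\<And>k. dyadic_energy k w \<le> C" using w by (auto simp: finite_energy_paths_def)
  have "Cauchy (\<lambda>k. dyadic_approx k t w)"
  proof (rule metric_CauchyI)
    fix e :: real assume e: "e > 0"
    have "(\<lambda>k. (1 / 2) ^ k * C) \<longlonglongrightarrow> 0"
      using tendsto_mult_right[OF LIMSEQ_realpow_zero[of "1/2::real"], of C] by simp
    moreover have "(e / 2)\<^sup>2 > 0" using e by simp
    ultimately obtain N where N: "(1 / 2) ^ N * C < (e / 2)\<^sup>2"
      using order_tendstoD(2)[of _ 0 sequentially "(e/2)\<^sup>2"] by (metis eventually_sequentially order_refl)
    have "dist (dyadic_approx l t w) (dyadic_approx N t w) < e / 2" if "N \<le> l" for l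
    proof -
      have "(dist (dyadic_approx l t w) (dyadic_approx N t w))\<^sup>2 < (e / 2)\<^sup>2"
        using dyadic_approx_refine_dist_sq_le[OF _ _ C that, of t] t N by auto
      then show ?thesis using e by (metis power2_less_imp_less less_imp_le half_gt_zero)
    qed
    then show "\<exists>M. \<forall>m\<ge>M. \<forall>n\<ge>M. dist (dyadic_approx m t w) (dyadic_approx n t w) < e"
      using dist_triangle_half_l by blast
  qed
  then show ?thesis by (simp add: Cauchy_convergent_iff convergent_LIMSEQ_iff)
qed

text \<open>The fixed value on paths of infinite energy makes every coordinate measurable on the
  whole path space, as a pointwise limit everywhere.\<close>

definition limit_process :: "real \<Rightarrow> (rat \<Rightarrow> 'a::compact_metric_space) \<Rightarrow> 'a" where
  "limit_process t w = (if w \<in> finite_energy_paths \<and> t \<in> {0..1} then lim (\<lambda>k. dyadic_approx k t w) else undefined)"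

lemma dyadic_approx_tendsto_limit_process:
  assumes "w \<in> finite_energy_paths" "t \<in> {0..1}"
  shows "(\<lambda>k. dyadic_approx k t w) \<longlonglongrightarrow> limit_process t w"
  using dyadic_approx_convergent[OF assms] assms by (simp add: limit_process_def)

lemma continuous_limit_process:
  assumes w: "w \<in> finite_energy_paths"
  shows "continuous_on {0..1} (\<lambda>t. limit_process t w)"
proof -
  obtain C where C: "\<And>k. dyadic_energy k w \<le> C" using w by (auto simp: finite_energy_paths_def)
  have C0: "0 \<le> C" using C[of 0] dyadic_energy_nonneg[of 0 w] by linarith
  have H: "(dist (limit_process t w) (limit_process s w))\<^sup>2 \<le> (t - s) * C" if st: "0 \<le> s" "s \<le> t" "t \<le> 1" for s t
  proof (rule LIMSEQ_le)
    show "(\<lambda>k. (dist (dyadic_approx k t w) (dyadic_approx k s w))\<^sup>2) \<longlonglongrightarrow> (dist (limit_process t w) (limit_process s w))\<^sup>2"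
      using st by (intro tendsto_power tendsto_dist dyadic_approx_tendsto_limit_process[OF w]) auto
    show "(\<lambda>k. (real (dyadic_floor k t) / 2 ^ k - real (dyadic_floor k s) / 2 ^ k) * C) \<longlonglongrightarrow> (t - s) * C"
      using st by (intro tendsto_mult_right tendsto_diff dyadic_floor_tendsto) auto
    show "\<exists>N. \<forall>n\<ge>N. (dist (dyadic_approx n t w) (dyadic_approx n s w))\<^sup>2 \<le> (real (dyadic_floor n t) / 2 ^ n - real (dyadic_floor n s) / 2 ^ n) * C"
      using dyadic_approx_dist_sq_le[OF st C] by blast
  qed
  then have H': "(dist (limit_process t w) (limit_process s w))\<^sup>2 \<le> \<bar>t - s\<bar> * C" if "s \<in> {0..1}" "t \<in> {0..1}" for s t
    using H[of s t] H[of t s] that by (cases "s \<le> t") (auto simp: dist_commute)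
  show ?thesis
    unfolding continuous_on_iff
  proof (intro ballI allI impI)
    fix t e :: real assume t: "t \<in> {0..1}" and e: "e > 0"
    show "\<exists>d>0. \<forall>s\<in>{0..1}. dist s t < d \<longrightarrow> dist (limit_process s w) (limit_process t w) < e"
    \<comment> \<open>Read off from the Hoelder bound d^2 <= \<bar>s - t\<bar> C; the 1 is added
      because C may be 0.\<close>
    proof (intro exI[of _ "e\<^sup>2 / (C + 1)"] conjI ballI impI)
      show "0 < e\<^sup>2 / (C + 1)" using e C0 by simp
      fix s assume s: "s \<in> {0..1}" "dist s t < e\<^sup>2 / (C + 1)"
      have "(dist (limit_process s w) (limit_process t w))\<^sup>2 \<le> \<bar>s - t\<bar> * C" by (rule H'[OF t s(1)])
      also have "\<dots> \<le> \<bar>s - t\<bar> * (C + 1)" by (intro mult_left_mono) auto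
      also have "\<dots> < e\<^sup>2" using s(2) C0 by (simp add: dist_real_def pos_less_divide_eq)
      finally show "dist (limit_process s w) (limit_process t w) < e"
        using e by (metis power2_less_imp_less less_imp_le)
    qed
  qed
qed

lemma finite_energy_paths_measurable [measurable]:
  "(finite_energy_paths :: (rat \<Rightarrow> 'a::compact_metric_space) set) \<in> sets borel"
proof -
  have "{w \<in> space (borel :: (rat \<Rightarrow> 'a) measure). \<exists>C::nat. \<forall>k. dyadic_energy k w \<le> real C} \<in> sets borel"
    by measurable
  then show ?thesis by (simp add: finite_energy_paths_def)
qed

lemma measurable_dyadic_approx [measurable]:
  "dyadic_approx k t \<in> borel_measurable (borel :: (rat \<Rightarrow> 'a::compact_metric_space) measure)"
  unfolding dyadic_approx_def by measurable

lemma measurable_limit_process [measurable]: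
  "limit_process t \<in> borel_measurable (borel :: (rat \<Rightarrow> 'a::compact_metric_space) measure)"
proof (rule borel_measurable_LIMSEQ_metric)
  show "(\<lambda>w. if w \<in> finite_energy_paths \<and> t \<in> {0..1} then dyadic_approx k t w else undefined)
      \<in> borel_measurable (borel :: (rat \<Rightarrow> 'a) measure)" for k by measurable
  show "(\<lambda>k. if w \<in> finite_energy_paths \<and> t \<in> {0..1} then dyadic_approx k t w else undefined) \<longlonglongrightarrow> limit_process t w" for w :: "rat \<Rightarrow> 'a"
    using dyadic_approx_tendsto_limit_process[of w t] by (auto simp: limit_process_def)
qed

section \<open>Law and energy of the limit process\<close>

lemma AE_finite_energy_paths:
  fixes P :: "(rat \<Rightarrow> 'a::compact_metric_space) measure"
  assumes P: "P \<in> space (prob_algebra borel)" and C: "\<And>m. (\<integral>w. dyadic_energy m w \<partial>P) \<le> C"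
  shows "AE w in P. w \<in> finite_energy_paths"
proof -
  have [measurable_cong]: "sets P = sets borel" using P by (simp add: space_prob_algebra)
  have "(\<integral>\<^sup>+w. (SUP k. ennreal (dyadic_energy k w)) \<partial>P) = (SUP k. \<integral>\<^sup>+w. ennreal (dyadic_energy k w) \<partial>P)"
    by (rule nn_integral_monotone_convergence_SUP)
      (auto intro!: monoI ennreal_leI dyadic_energy_mono simp: incseq_def le_fun_def)
  also have "\<dots> \<le> ennreal C"
  proof (rule SUP_least)
    fix k
    have "(\<integral>\<^sup>+w. ennreal (dyadic_energy k w) \<partial>P) = ennreal (\<integral>w. dyadic_energy k w \<partial>P)"
      by (intro nn_integral_eq_integral integrable_dyadic_energy P) (auto simp: dyadic_energy_nonneg)
    then show "(\<integral>\<^sup>+w. ennreal (dyadic_energy k w) \<partial>P) \<le> ennreal C" using C by (simp add: ennreal_leI)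
  qed
  finally have "(\<integral>\<^sup>+w. (SUP k. ennreal (dyadic_energy k w)) \<partial>P) < \<infinity>" by (simp add: le_less_trans[of _ "ennreal C"])
  then have "AE w in P. (SUP k. ennreal (dyadic_energy k w)) \<noteq> \<infinity>"
    by (intro nn_integral_PInf_AE) auto
  then show ?thesis
  proof eventually_elim
    fix w :: "rat \<Rightarrow> 'a"
    let ?S = "SUP k. ennreal (dyadic_energy k w)"
    assume fin: "?S \<noteq> \<infinity>"
    have le: "dyadic_energy k w \<le> enn2real ?S" for k
    proof -
      have "ennreal (dyadic_energy k w) \<le> ?S" by (rule SUP_upper) simp
      then have "enn2real (ennreal (dyadic_energy k w)) \<le> enn2real ?S"
        using fin by (intro enn2real_mono) (simp_all only: less_top infinity_ennreal_def)
      then show ?thesis by (simp add: dyadic_energy_nonneg)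
    qed
    obtain C :: nat where "enn2real ?S \<le> real C" using real_arch_simple by blast
    then show "w \<in> finite_energy_paths" using le order_trans unfolding finite_energy_paths_def by blast
  qed
qed

text \<open>The approximations at \<open>t\<close> have the laws of \<gamma> at the rounded times.
  Their test integrals tend to those of the limit variable by dominated convergence, and to those of
  \<open>\<gamma> t\<close> because \<gamma> is 1/2-Hoelder in the Wasserstein distance.\<close>

lemma distr_limit_process:
  fixes \<gamma> :: "real \<Rightarrow> 'a::compact_metric_space measure"
  assumes \<gamma>: "\<And>t. t \<in> {0..1} \<Longrightarrow> \<gamma> t \<in> space (prob_algebra borel)"
    and E: "energy wasserstein \<gamma> < \<infinity>"
    and P: "P \<in> space (prob_algebra borel)" and ae: "AE w in P. w \<in> finite_energy_paths"
    and marg: "\<And>m i. i \<le> 2 ^ m \<Longrightarrow> distr P borel (\<lambda>w. w (dyad m i)) = \<gamma> (real i / 2 ^ m)"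
    and t: "t \<in> {0..1}"
  shows "distr P borel (limit_process t) = \<gamma> t"
proof (rule measure_eqI_lipschitz)
  have p: "prob_space P" and [measurable_cong]: "sets P = sets borel" using P by (auto simp: space_prob_algebra)
  interpret prob_space P by (rule p)
  show "distr P borel (limit_process t) \<in> space (prob_algebra borel)"
    by (auto simp: space_prob_algebra intro!: prob_space_distr)
  show "\<gamma> t \<in> space (prob_algebra borel)" by (rule \<gamma>[OF t])
  fix f :: "'a \<Rightarrow> real" and c assume c: "c > 0" and f: "\<And>x y. \<bar>f x - f y\<bar> \<le> c * dist x y"
    and f01: "\<And>x. f x \<in> {0..1}"
  have fc: "continuous_on UNIV f"
    using f c by (intro lipschitz_on_continuous_on[of c] lipschitz_onI) (auto simp: dist_real_def)
  then have [measurable]: "f \<in> borel_measurable borel" by (rule borel_measurable_continuous_onI)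
  let ?C = "enn2real (energy wasserstein \<gamma>)"
  have "(\<lambda>k. \<integral>w. f (dyadic_approx k t w) \<partial>P) \<longlonglongrightarrow> (\<integral>w. f (limit_process t w) \<partial>P)"
  proof (rule integral_dominated_convergence[where w="\<lambda>_. 1"])
    show "AE w in P. (\<lambda>k. f (dyadic_approx k t w)) \<longlonglongrightarrow> f (limit_process t w)"
      using ae
    proof eventually_elim
      fix w :: "rat \<Rightarrow> 'a" assume "w \<in> finite_energy_paths"
      from dyadic_approx_tendsto_limit_process[OF this t] show "(\<lambda>k. f (dyadic_approx k t w)) \<longlonglongrightarrow> f (limit_process t w)"
        using fc by (auto intro: continuous_on_tendsto_compose)
    qed
    show "AE w in P. norm (f (dyadic_approx k t w)) \<le> 1" for k using f01 by (intro AE_I2) force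
  qed auto
  moreover have "(\<lambda>k. \<integral>w. f (dyadic_approx k t w) \<partial>P) \<longlonglongrightarrow> (\<integral>x. f x \<partial>\<gamma> t)"
  proof (rule metric_LIMSEQ_I)
    fix e :: real assume e: "e > 0"
    have "(\<lambda>k. c * sqrt ((t - real (dyadic_floor k t) / 2 ^ k) * ?C)) \<longlonglongrightarrow> c * sqrt ((t - t) * ?C)"
      using t by (intro tendsto_intros dyadic_floor_tendsto) auto
    then have "eventually (\<lambda>k. c * sqrt ((t - real (dyadic_floor k t) / 2 ^ k) * ?C) < e) sequentially"
      using e by (intro order_tendstoD(2)) auto
    then obtain N where N: "\<And>k. k \<ge> N \<Longrightarrow> c * sqrt ((t - real (dyadic_floor k t) / 2 ^ k) * ?C) < e"
      by (auto simp: eventually_sequentially)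
    have "dist (\<integral>w. f (dyadic_approx k t w) \<partial>P) (\<integral>x. f x \<partial>\<gamma> t) < e" if "k \<ge> N" for k
    proof -
      define q where "q = real (dyadic_floor k t) / 2 ^ k"
      have q: "0 \<le> q" "q \<le> t" using dyadic_floor_bounds(1)[of t k] t by (auto simp: q_def field_simps)
      have \<gamma>q: "\<gamma> q \<in> space (prob_algebra borel)" using q t by (intro \<gamma>) auto
      have "(\<integral>w. f (dyadic_approx k t w) \<partial>P) = (\<integral>x. f x \<partial>distr P borel (\<lambda>w. w (dyad k (dyadic_floor k t))))"
        unfolding dyadic_approx_def by (rule integral_distr[symmetric]) measurable
      also have "\<dots> = (\<integral>x. f x \<partial>\<gamma> q)" using marg[OF dyadic_floor_le[of t k]] t by (simp add: q_def)
      finally have "dist (\<integral>w. f (dyadic_approx k t w) \<partial>P) (\<integral>x. f x \<partial>\<gamma> t) = \<bar>(\<integral>x. f x \<partial>\<gamma> t) - (\<integral>x. f x \<partial>\<gamma> q)\<bar>"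
        by (simp add: dist_real_def abs_minus_commute)
      also have "\<dots> \<le> c * wasserstein (\<gamma> t) (\<gamma> q)"
        by (rule lipschitz_integral_diff_le_wasserstein[OF \<gamma>[OF t] \<gamma>q c f])
      also have "wasserstein (\<gamma> t) (\<gamma> q) \<le> sqrt ((t - q) * ?C)"
      \<comment> \<open>The increment bound requires strictly ordered times, whereas a dyadic
        \<open>t\<close> may equal its own rounding.\<close>
      proof (cases "q = t")
        case True
        have "(wasserstein (\<gamma> t) (\<gamma> t))\<^sup>2 \<le> 0"
          using wasserstein_self[OF \<gamma>[OF t]] by simp
        then show ?thesis using True by simp
      next
        case False
        then show ?thesis using energy_increment_le[OF E, of q t] q t by (intro real_le_rsqrt) auto
      qed
      finally show ?thesis using N[OF that] c by (simp add: q_def)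
    qed
    then show "\<exists>N. \<forall>k\<ge>N. dist (\<integral>w. f (dyadic_approx k t w) \<partial>P) (\<integral>x. f x \<partial>\<gamma> t) < e" by blast
  qed
  ultimately have "(\<integral>w. f (limit_process t w) \<partial>P) = (\<integral>x. f x \<partial>\<gamma> t)" by (rule LIMSEQ_unique)
  then show "(\<integral>x. f x \<partial>distr P borel (limit_process t)) = (\<integral>x. f x \<partial>\<gamma> t)" by (simp add: integral_distr)
qed

text \<open>The partition is rounded to the grid of level k. Path by path the rounded energy sum is
  at most the dyadic energy, so its expectation is at most C, and with k tending to infinity
  numerators and denominators converge to those of the given partition.\<close>

lemma energy_limit_process_le:
  fixes P :: "(rat \<Rightarrow> 'a::compact_metric_space) measure"
  assumes P: "P \<in> space (prob_algebra borel)" and ae: "AE w in P. w \<in> finite_energy_paths"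
    and C: "\<And>m. (\<integral>w. dyadic_energy m w \<partial>P) \<le> C"
  shows "energy (L2_dist P) limit_process \<le> ennreal C"
  unfolding energy_def
proof (rule SUP_least, clarify)
  fix n t assume up: "unit_partition n t"
  have p: "prob_space P" and [measurable_cong]: "sets P = sets borel" using P by (auto simp: space_prob_algebra)
  interpret prob_space P by (rule p)
  obtain D where D: "D > 0" "\<And>x y :: 'a. dist x y \<le> D" using compact_metric_bounded[where 'a='a] by blast
  have t0: "t 0 = 0" and tn: "t n = 1" and step: "\<And>i. i \<in> {1..n} \<Longrightarrow> t (i - 1) < t i"
    using up by (auto simp: unit_partition_def)
  note t01 = unit_partition_range[OF up]
  have int: "integrable P (\<lambda>w. (dist (dyadic_approx k a w) (dyadic_approx k b w))\<^sup>2)" for k a b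
    by (rule integrable_bounded_dist[OF p]) measurable
  have conv: "(\<lambda>k. \<integral>w. (dist (dyadic_approx k a w) (dyadic_approx k b w))\<^sup>2 \<partial>P) \<longlonglongrightarrow> (L2_dist P (limit_process a) (limit_process b))\<^sup>2"
    if ab: "a \<in> {0..1}" "b \<in> {0..1}" for a b
  proof -
    have "(\<lambda>k. \<integral>w. (dist (dyadic_approx k a w) (dyadic_approx k b w))\<^sup>2 \<partial>P) \<longlonglongrightarrow> (\<integral>w. (dist (limit_process a w) (limit_process b w))\<^sup>2 \<partial>P)"
    proof (rule integral_dominated_convergence[where w="\<lambda>_. D\<^sup>2"])
      show "AE w in P. (\<lambda>k. (dist (dyadic_approx k a w) (dyadic_approx k b w))\<^sup>2) \<longlonglongrightarrow> (dist (limit_process a w) (limit_process b w))\<^sup>2"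
        using ae by eventually_elim (intro tendsto_power tendsto_dist dyadic_approx_tendsto_limit_process ab)
      show "AE w in P. norm ((dist (dyadic_approx k a w) (dyadic_approx k b w))\<^sup>2) \<le> D\<^sup>2" for k
        using D by (intro AE_I2) (auto intro: power_mono)
    qed auto
    then show ?thesis by (simp add: L2_dist_def)
  qed
  have "(\<lambda>k. \<Sum>i=1..n. (\<integral>w. (dist (dyadic_approx k (t i) w) (dyadic_approx k (t (i - 1)) w))\<^sup>2 \<partial>P)
      / (real (dyadic_floor k (t i)) / 2 ^ k - real (dyadic_floor k (t (i - 1))) / 2 ^ k))
    \<longlonglongrightarrow> (\<Sum>i=1..n. (L2_dist P (limit_process (t i)) (limit_process (t (i - 1))))\<^sup>2 / (t i - t (i - 1)))"
  proof (intro tendsto_sum tendsto_divide conv tendsto_diff dyadic_floor_tendsto)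
    fix i assume i: "i \<in> {1..n}"
    show "t i \<in> {0..1}" "t (i - 1) \<in> {0..1}" "0 \<le> t i" "0 \<le> t (i - 1)"
      using i t01[of i] t01[of "i - 1"] by auto
    show "t i - t (i - 1) \<noteq> 0" using step[OF i] by simp
  qed
  \<comment> \<open>This holds at every level: if two partition times round to the same grid point,
    their term is 0/0, which is 0.\<close>
  moreover have "(\<Sum>i=1..n. (\<integral>w. (dist (dyadic_approx k (t i) w) (dyadic_approx k (t (i - 1)) w))\<^sup>2 \<partial>P)
      / (real (dyadic_floor k (t i)) / 2 ^ k - real (dyadic_floor k (t (i - 1))) / 2 ^ k)) \<le> C" for k
  proof -
    have "(\<Sum>i=1..n. (\<integral>w. (dist (dyadic_approx k (t i) w) (dyadic_approx k (t (i - 1)) w))\<^sup>2 \<partial>P)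
        / (real (dyadic_floor k (t i)) / 2 ^ k - real (dyadic_floor k (t (i - 1))) / 2 ^ k))
      = (\<integral>w. (\<Sum>i=1..n. (dist (dyadic_approx k (t i) w) (dyadic_approx k (t (i - 1)) w))\<^sup>2
        / (real (dyadic_floor k (t i)) / 2 ^ k - real (dyadic_floor k (t (i - 1))) / 2 ^ k)) \<partial>P)"
      using int by (subst Bochner_Integration.integral_sum) auto
    also have "\<dots> \<le> (\<integral>w. dyadic_energy k w \<partial>P)"
    proof (rule integral_mono)
      show "integrable P (\<lambda>w. \<Sum>i=1..n. (dist (dyadic_approx k (t i) w) (dyadic_approx k (t (i - 1)) w))\<^sup>2
        / (real (dyadic_floor k (t i)) / 2 ^ k - real (dyadic_floor k (t (i - 1))) / 2 ^ k))"
        using int by auto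
      show "integrable P (dyadic_energy k)" by (rule integrable_dyadic_energy[OF P])
      fix w
      show "(\<Sum>i=1..n. (dist (dyadic_approx k (t i) w) (dyadic_approx k (t (i - 1)) w))\<^sup>2
        / (real (dyadic_floor k (t i)) / 2 ^ k - real (dyadic_floor k (t (i - 1))) / 2 ^ k)) \<le> dyadic_energy k w"
        unfolding dyadic_approx_def
      proof (rule dyadic_steps_le)
        show "dyadic_floor k (t 0) = 0" "dyadic_floor k (t n) = 2 ^ k" by (simp_all add: t0 tn)
        show "dyadic_floor k (t (j - 1)) \<le> dyadic_floor k (t j)" if "j \<in> {1..n}" for j
          using step[OF that] by (intro dyadic_floor_mono) simp
      qed
    qed
    also have "\<dots> \<le> C" by (rule C)
    finally show ?thesis .
  qed
  ultimately have "(\<Sum>i=1..n. (L2_dist P (limit_process (t i)) (limit_process (t (i - 1))))\<^sup>2 / (t i - t (i - 1))) \<le> C"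
    by (intro LIMSEQ_le_const2) auto
  then show "ennreal (\<Sum>i=1..n. (L2_dist P (limit_process (t i)) (limit_process (t (i - 1))))\<^sup>2 / (t i - t (i - 1))) \<le> ennreal C"
    by (rule ennreal_leI)
qed

lemma energy_wasserstein_le:
  fixes X :: "real \<Rightarrow> 'w \<Rightarrow> 'a::compact_metric_space"
  assumes M: "prob_space M" and X: "\<And>t. t \<in> {0..1} \<Longrightarrow> X t \<in> borel_measurable M"
    and law: "\<And>t. t \<in> {0..1} \<Longrightarrow> distr M borel (X t) = \<gamma> t"
  shows "energy wasserstein \<gamma> \<le> energy (L2_dist M) X"
  unfolding energy_def
proof (rule SUP_mono, clarify)
  fix n t assume up: "unit_partition n t"
  have step: "\<And>i. i \<in> {1..n} \<Longrightarrow> t (i - 1) < t i"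
    using up by (auto simp: unit_partition_def)
  note t01 = unit_partition_range[OF up]
  have "(\<Sum>i=1..n. (wasserstein (\<gamma> (t i)) (\<gamma> (t (i - 1))))\<^sup>2 / (t i - t (i - 1)))
      \<le> (\<Sum>i=1..n. (L2_dist M (X (t i)) (X (t (i - 1))))\<^sup>2 / (t i - t (i - 1)))"
  proof (intro sum_mono divide_right_mono power_mono)
    fix i assume i: "i \<in> {1..n}"
    then have "t i \<in> {0..1}" "t (i - 1) \<in> {0..1}" using t01[of i] t01[of "i - 1"] by auto
    note m = X[OF this(1)] X[OF this(2)] and l = law[OF this(1)] law[OF this(2)]
    show "wasserstein (\<gamma> (t i)) (\<gamma> (t (i - 1))) \<le> L2_dist M (X (t i)) (X (t (i - 1)))"
      using wasserstein_le_L2_dist[OF M m] unfolding l .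
    show "0 \<le> wasserstein (\<gamma> (t i)) (\<gamma> (t (i - 1)))"
      unfolding l[symmetric] using m[THEN prob_space.prob_space_distr[OF M]]
      by (intro wasserstein_nonneg) (simp_all only: space_prob_algebra mem_Collect_eq sets_distr simp_thms)
    show "0 \<le> t i - t (i - 1)" using step[OF i] by simp
  qed
  then show "\<exists>q\<in>{(n, t). unit_partition n t}.
      ennreal (\<Sum>i=1..n. (wasserstein (\<gamma> (t i)) (\<gamma> (t (i - 1))))\<^sup>2 / (t i - t (i - 1)))
      \<le> (case q of (n, t) \<Rightarrow> ennreal (\<Sum>i=1..n. (L2_dist M (X (t i)) (X (t (i - 1))))\<^sup>2 / (t i - t (i - 1))))"
    using up by (intro bexI[of _ "(n, t)"]) (auto intro: ennreal_leI)
qed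

theorem theorem5:
  fixes \<gamma> :: "real \<Rightarrow> 'a::compact_metric_space measure"
  assumes "wasserstein_path \<gamma>"
    and "energy wasserstein \<gamma> < \<infinity>"
  shows "\<exists>(M :: (real \<Rightarrow> 'a) measure) X.
    prob_space M \<and> realizes M X \<gamma> \<and> energy (L2_dist M) X = energy wasserstein \<gamma>"
proof -
  let ?C = "enn2real (energy wasserstein \<gamma>)"
  have \<gamma>: "\<gamma> t \<in> space (prob_algebra borel)" if "t \<in> {0..1}" for t
    by (rule wasserstein_path_prob[OF assms that])
  obtain P :: "(rat \<Rightarrow> 'a) measure" where P: "P \<in> space (prob_algebra borel)"
    and marg: "\<And>m i. i \<le> 2 ^ m \<Longrightarrow> distr P borel (\<lambda>w. w (dyad m i)) = \<gamma> (real i / 2 ^ m)"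
    and C: "\<And>m. (\<integral>w. dyadic_energy m w \<partial>P) \<le> ?C"
    using dyadic_law[of \<gamma>, OF \<gamma> assms(2)] by blast
  have p: "prob_space P" and sP: "sets P = sets borel" using P by (auto simp: space_prob_algebra)
  have ae: "AE w in P. w \<in> finite_energy_paths" by (rule AE_finite_energy_paths[OF P C])
  \<comment> \<open>The process on \<open>rat \<Rightarrow> 'a\<close> is moved to the sample space
    \<open>real \<Rightarrow> 'a\<close>: \<open>R\<close> restricts to rational times, and
    \<open>J\<close> is a right inverse of it whose values at irrational times are
    arbitrary.\<close>
  define R :: "(real \<Rightarrow> 'a) \<Rightarrow> rat \<Rightarrow> 'a" where "R \<eta> q = \<eta> (of_rat q)" for \<eta> q
  define J :: "(rat \<Rightarrow> 'a) \<Rightarrow> real \<Rightarrow> 'a" where "J w t = w (inv of_rat t)" for w t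
  have RJ: "R (J w) = w" for w
    by (rule ext) (simp add: R_def J_def inv_f_f inj_def)
  \<comment> \<open>The sigma-algebra generated by \<open>R\<close>. It makes \<open>R\<close>
    measurable by construction, and \<open>J\<close> as well because \<open>R\<close> after
    \<open>J\<close> is the identity.\<close>
  define V where "V = vimage_algebra UNIV R (borel :: (rat \<Rightarrow> 'a) measure)"
  have R: "R \<in> V \<rightarrow>\<^sub>M borel" unfolding V_def by (rule measurable_vimage_algebra1) simp
  have J: "J \<in> P \<rightarrow>\<^sub>M V"
    unfolding V_def by (rule measurable_vimage_algebra2) (auto simp: RJ sP cong: measurable_cong_sets)
  define M where "M = distr P V J"
  define X where "X t \<eta> = limit_process t (R \<eta>)" for t \<eta>
  have M: "prob_space M" unfolding M_def by (rule prob_space.prob_space_distr[OF p J])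
  have RM[measurable]: "R \<in> M \<rightarrow>\<^sub>M borel" using R by (simp add: M_def)
  have MR: "distr M borel R = P"
    unfolding M_def by (subst distr_distr[OF R J]) (simp add: comp_def RJ distr_id2 sP)
  have Xm: "X t \<in> borel_measurable M" for t
    unfolding X_def by (rule measurable_compose[OF RM measurable_limit_process])
  have Xl: "distr M borel (X t) = \<gamma> t" if t: "t \<in> {0..1}" for t
  proof -
    have "distr M borel (X t) = distr (distr M borel R) borel (limit_process t)"
      by (subst distr_distr[OF measurable_limit_process RM]) (simp add: X_def[abs_def] comp_def)
    then show ?thesis unfolding MR using distr_limit_process[OF \<gamma> assms(2) P ae marg t] by simp
  qed
  have "AE \<eta> in M. R \<eta> \<in> finite_energy_paths"
    by (rule AE_distrD[OF RM]) (unfold MR, rule ae)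
  then have "AE \<eta> in M. continuous_on {0..1} (\<lambda>t. X t \<eta>)"
    by eventually_elim (simp add: X_def continuous_limit_process)
  then have real: "realizes M X \<gamma>" using Xm Xl by (auto simp: realizes_def)
  have L2: "L2_dist M (X s) (X t) = L2_dist P (limit_process s) (limit_process t)" for s t
  proof -
    have "(\<integral>w. (dist (limit_process s w) (limit_process t w))\<^sup>2 \<partial>distr M borel R)
      = (\<integral>\<eta>. (dist (X s \<eta>) (X t \<eta>))\<^sup>2 \<partial>M)"
      unfolding X_def by (rule integral_distr) measurable
    then show ?thesis by (simp add: L2_dist_def MR)
  qed
  \<comment> \<open>The energy sees a process only through its pairwise L2 distances, and these
    survive the change of sample space.\<close>
  have "energy (L2_dist M) X = energy (L2_dist P) limit_process"
    unfolding energy_def L2 ..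
  also have "\<dots> \<le> ennreal ?C" by (rule energy_limit_process_le[OF P ae C])
  also have "ennreal ?C = energy wasserstein \<gamma>" using assms(2) by simp
  finally have "energy (L2_dist M) X \<le> energy wasserstein \<gamma>" .
  moreover have "energy wasserstein \<gamma> \<le> energy (L2_dist M) X"
    by (rule energy_wasserstein_le[OF M Xm Xl])
  ultimately show ?thesis using M real by (intro exI[of _ M] exI[of _ X]) auto
qed

end
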